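(* Let $n \geq 2$ and $a_n$ be integers. Let $\phi(x)\in \mathbb{Z}[x]$ be a monic polynomial which is irreducible modulo every prime less than $2n$. Suppose that $a_0(x), \dots, a_{n-1}(x)\in \mathbb{Z}[x]$ satisfy: (i) $\deg a_i(x) < \deg \phi(x)$ for $0\leq i\leq n-1$; (ii) the content of the polynomial $a_n a_0(x)$ is not divisible by any prime less than $2n$. Then the polynomial $$f_1(x)= \frac{a_{n}}{u_{2n}}\phi(x)^{2n}+\sum_{j=0}^{n-1}a_j(x)\frac{\phi(x)^{2j}}{u_{2j}}$$ is irreducible over $\mathbb{Q}$.
   Context: For each non-negative integer $j$, $u_j$ denotes the product of the odd positive integers $\leq j$ (so $u_0=u_2=1$, $u_4=3$, $u_6=15$, ...). A polynomial in $\mathbb{Z}[x]$ is irreducible modulo a prime $p$ if its reduction modulo $p$ is irreducible in $(\mathbb{Z}/p\mathbb{Z})[x]$. The content of a polynomial in $\mathbb{Z}[x]$ is the greatest common divisor of its coefficients. *)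

theory Defs
  imports "HOL-Computational_Algebra.Computational_Algebra" "Berlekamp_Zassenhaus.Poly_Mod"
begin

definition u :: "nat \<Rightarrow> int" where
  "u j = (\<Prod>i\<in>{i\<in>{1..j}. odd i}. int i)"

definition irreducible_mod :: "int \<Rightarrow> int poly \<Rightarrow> bool" where
  "irreducible_mod p f = poly_mod.irreducible_m p f"

end

theory Submission
  imports "HOL-Analysis.Harmonic_Numbers" "HOL-Analysis.Complex_Transcendental" Defs
begin

text \<open>
  After clearing denominators the polynomial is \<open>F = \<Sum> c\<^sub>j a\<^sub>j \<phi>\<^sup>2\<^sup>j\<close> with
  \<open>c\<^sub>j = u\<^sub>2\<^sub>n / u\<^sub>2\<^sub>j\<close>.  Suppose \<open>F = G H\<close> over the integers with
  \<open>deg G \<le> deg H\<close>, and let \<open>k\<close> be the integer part of \<open>deg G / deg \<phi>\<close> and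
  \<open>l = max 1 \<lceil>k/2\<rceil>\<close>.  An analogue of Sylvester's theorem for odd numbers gives a prime
  \<open>p > 2l\<close> that divides one of \<open>2n-1, 2n-3, \<dots>, 2n-2l+1\<close>.  Modulo this \<open>p\<close> a power of
  \<open>\<phi>\<close> so large divides \<open>F\<close> that \<open>\<phi>\<close> must divide \<open>G\<close>.  Hence the \<open>p\<close>-adic Newton polygon
  of \<open>G\<close> with respect to \<open>\<phi>\<close> has a slope of size at least \<open>1/k\<close>, whereas all slopes of the
  polygon of \<open>F\<close> are smaller than \<open>1/k\<close> because \<open>(p-1) v\<^sub>p(u\<^sub>2\<^sub>j) < 2j\<close>.

  Sylvester's theorem for odd numbers follows Erdos: if all prime factors of
  \<open>m, m+2, \<dots>, m+2l-2\<close> are below \<open>2l\<close>, remove for every prime the term in which it has the highest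
  multiplicity; the other terms contribute at most the odd part of \<open>(l-1)!\<close>.  This bounds the
  product by \<open>odd((l-1)!)\<close> times a product of prime powers at most \<open>m+2l-2\<close>, which
  contradicts Chebyshev-type bounds for large \<open>l\<close>.
\<close>

subsection \<open>Counting odd primes\<close>

text \<open>The choice of l serves three purposes at once. The run of l odd numbers ends at 2n-1, so
  a prime p dividing one of them divides every c_j with j at most n-l, and phi^(2(n-l)+2) divides F
  modulo p. If k > 0 then k is at least 2l-1, and if k = 0 the power is phi^(2n); either way the
  degree of H is too small for this power, which forces phi into G. Since k is at most 2l and hence
  less than p, the factor p-1 in the valuation bound may be replaced by k. Finally deg G at most deg
  H yields 2l at most n+1, so that the run starts at 2l-1 or later, as the analogue of Sylvester's
  theorem requires.

  The slope of G is read off from two digits: digit 0 is divisible by p because phi divides G modulo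
  p, and the top digit k is not, because p does not divide a_n. The obstacle in the polygon argument
  is carrying: a product of two digits has to be reduced modulo phi again, so each digit of F mixes
  two neighbouring antidiagonals of digit products.\<close>

definition odd_primes :: "nat \<Rightarrow> nat set" where
  "odd_primes x = {p. prime p \<and> odd p \<and> p \<le> x}"

lemma finite_odd_primes [simp, intro]: "finite (odd_primes x)"
  by (rule finite_subset [of _ "{..x}"]) (auto simp: odd_primes_def)

text \<open>
  Primes above 7 are coprime to 210, and only \<open>48 < 210 / 4\<close> residues modulo 210 are.
\<close>

definition coprime_count :: "nat \<Rightarrow> nat" where
  "coprime_count y = card {x \<in> {1..y}. gcd x 210 = 1}"

lemma coprime_count_Suc:
  "coprime_count (Suc y) = (if gcd (Suc y) 210 = 1 then Suc (coprime_count y) else coprime_count y)"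
proof -
  have "{x \<in> {1..Suc y}. gcd x 210 = 1} =
        (if gcd (Suc y) 210 = 1 then insert (Suc y) {x \<in> {1..y}. gcd x 210 = 1}
         else {x \<in> {1..y}. gcd x 210 = 1})"
    by (auto simp: le_Suc_eq)
  then show ?thesis
    by (auto simp: coprime_count_def)
qed

text \<open>A single pass with a running count, so that evaluating one term certifies the final
  count together with all intermediate bounds. The list entry \<open>y\<close> tests the bound at
  \<open>Suc y\<close>.\<close>

primrec coprime_count_bound :: "nat list \<Rightarrow> nat \<Rightarrow> nat option" where
  "coprime_count_bound [] c = Some c"
| "coprime_count_bound (y # ys) c =
     (let c' = if gcd (Suc y) 210 = 1 then Suc c else c
      in if 4 * c' \<le> y + 2 \<or> y < 2 then coprime_count_bound ys c' else None)"

lemma coprime_count_bound_Some: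
  "coprime_count_bound [a..<a + k] (coprime_count a) = Some c \<Longrightarrow>
     coprime_count (a + k) = c \<and> (\<forall>y\<in>{a<..a + k}. y < 3 \<or> 4 * coprime_count y \<le> y + 1)"
proof (induction k arbitrary: a)
  case 0
  then show ?case by simp
next
  case (Suc k)
  have *: "[a..<a + Suc k] = a # [Suc a..<Suc a + k]"
    by (simp add: upt_rec)
  have ok: "Suc a < 3 \<or> 4 * coprime_count (Suc a) \<le> Suc a + 1"
    using Suc.prems unfolding * by (auto simp: Let_def coprime_count_Suc split: if_splits)
  have "coprime_count_bound [Suc a..<Suc a + k] (coprime_count (Suc a)) = Some c"
    using Suc.prems unfolding * by (auto simp: Let_def coprime_count_Suc split: if_splits)
  note IH = Suc.IH [OF this]
  show ?case
  proof (intro conjI ballI)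
    show "coprime_count (a + Suc k) = c" using IH by simp
  next
    fix y assume "y \<in> {a<..a + Suc k}"
    then have "y = Suc a \<or> y \<in> {Suc a<..Suc a + k}" by auto
    then show "y < 3 \<or> 4 * coprime_count y \<le> y + 1"
      using IH ok by blast
  qed
qed

lemma coprime_count_210:
  "coprime_count 210 = 48" "\<And>y. y \<in> {0<..210} \<Longrightarrow> y < 3 \<or> 4 * coprime_count y \<le> y + 1"
proof -
  have "coprime_count_bound [0..<210] 0 = Some 48"
    by code_simp
  moreover have "coprime_count 0 = 0" by (simp add: coprime_count_def)
  ultimately have "coprime_count_bound [0..<0 + 210] (coprime_count 0) = Some 48"
    by simp
  from coprime_count_bound_Some [OF this]
  show "coprime_count 210 = 48" "\<And>y. y \<in> {0<..210} \<Longrightarrow> y < 3 \<or> 4 * coprime_count y \<le> y + 1"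
    by simp_all
qed

lemma coprime_count_add_210: "coprime_count (y + 210) = coprime_count y + 48"
proof (induction y)
  case 0
  show ?case using coprime_count_210(1) by (simp add: coprime_count_def [of 0])
next
  case (Suc y)
  have "gcd (Suc y + 210) 210 = gcd (Suc y) (210 :: nat)"
    by (rule gcd_add1)
  then have "gcd (Suc (y + 210)) 210 = 1 \<longleftrightarrow> gcd (Suc y) (210 :: nat) = 1"
    unfolding add_Suc by (simp only:)
  then show ?case using Suc coprime_count_Suc [of y] coprime_count_Suc [of "y + 210"] by auto
qed

lemma coprime_count_le: "3 \<le> y \<Longrightarrow> 4 * coprime_count y \<le> y + 1"
proof (induction y rule: less_induct)
  case (less y)
  show ?case
  \<comment> \<open>The bound fails at 1 and 2, so descending by 210 is possible only from 213 on;
    211 and 212 are computed separately.\<close>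
  proof (cases "y \<le> 212")
    case True
    have "gcd (Suc 1) (210 :: nat) \<noteq> 1" by code_simp
    then have *: "coprime_count (Suc 1) = coprime_count 1"
      by (simp only: coprime_count_Suc if_False)
    have "coprime_count 1 = 1"
      using coprime_count_Suc [of 0] by (simp add: coprime_count_def [of 0])
    with * have "coprime_count 1 = 1" "coprime_count 2 = 1"
      by (simp_all add: numeral_2_eq_2)
    then have "coprime_count 211 = 49" "coprime_count 212 = 49"
      using coprime_count_add_210 [of 1] coprime_count_add_210 [of 2] by simp_all
    moreover have "y = 211 \<or> y = 212 \<or> y \<in> {0<..210}" using True less.prems by auto
    ultimately show ?thesis using coprime_count_210(2) [of y] less.prems by auto
  next
    case False
    then have "4 * coprime_count (y - 210) \<le> y - 210 + 1" by (intro less.IH) auto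
    moreover have "coprime_count y = coprime_count (y - 210) + 48"
      using coprime_count_add_210 [of "y - 210"] False by simp
    ultimately show ?thesis using False by simp
  qed
qed

text \<open>Dropping 1 and adding 3, 5, 7 costs 2 over \<open>coprime_count x\<close>, and 9 = 1 + 4
  * 2.\<close>

lemma card_odd_primes_le: "4 * card (odd_primes x) \<le> x + 9"
proof (cases "x < 3")
  case True
  have "odd_primes x = {}"
  proof -
    have False if "prime p" "odd p" "p \<le> x" for p
    proof -
      have "p \<noteq> 2" using that(2) by auto
      with prime_ge_2_nat [OF that(1)] that(3) True show False by simp
    qed
    then show ?thesis by (auto simp: odd_primes_def)
  qed
  then show ?thesis by simp
next
  case False
  have sub: "odd_primes x \<subseteq> {3, 5, 7} \<union> ({y \<in> {1..x}. gcd y 210 = 1} - {1})"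
  proof
    fix p assume "p \<in> odd_primes x"
    then have p: "prime p" "odd p" "p \<le> x" by (auto simp: odd_primes_def)
    have "\<not> p dvd 210" if "p \<notin> {3, 5, 7}"
    proof
      assume "p dvd 210"
      then have "p dvd 2 * 3 * 5 * 7" by simp
      then have "p dvd 2 \<or> p dvd 3 \<or> p dvd 5 \<or> p dvd 7"
        using p(1) by (meson prime_dvd_mult_iff)
      moreover have "prime (2::nat)" "prime (3::nat)" "prime (5::nat)" "prime (7::nat)" by simp_all
      ultimately have "p \<in> {2, 3, 5, 7}"
        using primes_dvd_imp_eq [OF p(1)] by blast
      with that p(2) show False by auto
    qed
    then have "p \<notin> {3, 5, 7} \<Longrightarrow> gcd p 210 = 1"
      using p(1) gcd_nat.absorb_iff1 [of p 210] prime_nat_iff [of p] by (metis gcd_dvd1)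
    then show "p \<in> {3, 5, 7} \<union> ({y \<in> {1..x}. gcd y 210 = 1} - {1})"
      using p(3) prime_ge_2_nat [OF p(1)] by auto
  qed
  have fin: "finite {y \<in> {1..x}. gcd y 210 = 1}" by simp
  have "card (odd_primes x) \<le> card ({3, 5, 7} \<union> ({y \<in> {1..x}. gcd y 210 = 1} - {1}))"
    by (rule card_mono [OF _ sub]) simp
  also have "\<dots> \<le> card {3::nat, 5, 7} + card ({y \<in> {1..x}. gcd y 210 = 1} - {1})"
    by (rule card_Un_le)
  also have "card ({y \<in> {1..x}. gcd y 210 = 1} - {1}) = coprime_count x - 1"
    using False unfolding coprime_count_def by (subst card_Diff_singleton) auto
  also have "coprime_count x \<ge> 1"
    unfolding coprime_count_def using False card_mono [OF fin, of "{1}"] by auto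
  then have "card {3::nat, 5, 7} + (coprime_count x - 1) = coprime_count x + 2"
    by simp
  finally show ?thesis using coprime_count_le [of x] False by simp
qed

subsection \<open>The multiplicity of a prime in a factorial\<close>

text \<open>Legendre's formula as a recursion: the multiples of \<open>p\<close> up to
  \<open>N\<close>, divided by \<open>p\<close>, are the numbers up to
  \<open>N div p\<close>.\<close>

lemma multiplicity_fact_rec:
  fixes p :: nat
  assumes p: "prime p"
  shows "multiplicity p (fact N :: nat) = N div p + multiplicity p (fact (N div p) :: nat)"
proof (induction N)
  case 0
  show ?case by simp
next
  case (Suc N)
  have step: "multiplicity p (fact (Suc k) :: nat) = multiplicity p (Suc k) + multiplicity p (fact k :: nat)" for k
    using p by (simp add: prime_elem_multiplicity_mult_distrib del: mult_Suc)
  have p0: "p > 0" using p prime_gt_0_nat by blast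
  show ?case
  proof (cases "p dvd Suc N")
    case True
    then obtain q where q: "Suc N = p * q" by blast
    then obtain r where r: "q = Suc r" by (cases q) auto
    have "N = p * r + (p - 1)" using q r p0 by simp
    also have "\<dots> div p = r" using p0 by (intro div_nat_eqI) auto
    finally have div: "Suc N div p = Suc r" "N div p = r"
      using p0 by (simp_all add: q r del: mult_Suc_right)
    have "multiplicity p (Suc N) = Suc (multiplicity p (Suc r))"
      unfolding q r using p by (subst multiplicity_times_same) auto
    then show ?thesis
      unfolding div step using Suc.IH unfolding div by simp
  next
    case False
    then have "multiplicity p (Suc N) = 0" by (rule not_dvd_imp_multiplicity_0)
    moreover have "Suc N div p = N div p"
      using False by (simp add: div_Suc dvd_eq_mod_eq_0)
    ultimately show ?thesis unfolding step using Suc.IH by simp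
  qed
qed

text \<open>By Legendre's formula the left side is \<open>N\<close> minus the digit sum of
  \<open>N\<close> in base \<open>p\<close>.\<close>

lemma multiplicity_fact_less:
  fixes p :: nat
  assumes p: "prime p"
  shows "N > 0 \<Longrightarrow> (p - 1) * multiplicity p (fact N :: nat) < N"
proof (induction N rule: less_induct)
  case (less N)
  have p1: "p > 1" using p prime_gt_1_nat by blast
  show ?case
  proof (cases "N < p")
    case True
    then show ?thesis using multiplicity_fact_rec [OF p, of N] less.prems by simp
  next
    case False
    define q where "q = N div p"
    have q: "q > 0" "q < N" using False p1 by (auto simp: q_def div_greater_zero_iff)
    from less.IH [OF q(2,1)] have "(p - 1) * (q + multiplicity p (fact q :: nat)) < (p - 1) * q + q"
      by (simp add: distrib_left)
    also have "(p - 1) * q + q = p * q" using p1 by (cases p) auto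
    also have "p * q \<le> N" by (simp add: q_def)
    finally show ?thesis using multiplicity_fact_rec [OF p, of N] by (simp add: q_def)
  qed
qed

text \<open>\<open>N\<close> minus the multiplicity is the binary digit sum s of \<open>N\<close>,
  and a number with digit sum s is at least 2^s - 1.\<close>

lemma power2_le_multiplicity_fact: "2 ^ N \<le> (N + 1) * 2 ^ multiplicity 2 (fact N :: nat)"
proof (induction N rule: less_induct)
  case (less N)
  show ?case
  proof (cases "N = 0")
    case False
    define k where "k = N div 2"
    have N: "N = 2 * k \<or> N = 2 * k + 1" by (auto simp: k_def)
    have v: "multiplicity 2 (fact N :: nat) = k + multiplicity 2 (fact k :: nat)"
      using multiplicity_fact_rec [of 2 N] by (simp add: k_def)
    have "2 ^ k \<le> (k + 1) * 2 ^ multiplicity 2 (fact k :: nat)"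
      using less.IH [of k] False by (simp add: k_def)
    from mult_left_mono [OF this, of "2 ^ k"]
    have "2 ^ (2 * k) \<le> (k + 1) * 2 ^ multiplicity 2 (fact N :: nat)"
      unfolding v power_add mult_2 by (simp only: mult_ac)
    then have "2 ^ (2 * k + 1) \<le> (2 * k + 2) * 2 ^ multiplicity 2 (fact N :: nat)"
      "2 ^ (2 * k) \<le> (2 * k + 1) * 2 ^ multiplicity 2 (fact N :: nat)"
      by (simp_all add: distrib_right)
    with N show ?thesis by auto
  qed simp
qed

lemma odd_part_fact_le:
  "2 ^ N * (fact N div 2 ^ multiplicity 2 (fact N :: nat)) \<le> (fact (N + 1) :: nat)"
proof -
  define v where "v = multiplicity 2 (fact N :: nat)"
  define r where "r = (fact N :: nat) div 2 ^ v"
  have f: "fact N = 2 ^ v * r"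
    unfolding r_def v_def by (simp add: multiplicity_dvd)
  have "2 ^ N * r \<le> (N + 1) * 2 ^ v * r"
    using power2_le_multiplicity_fact [of N] by (intro mult_right_mono) (auto simp: v_def)
  also have "\<dots> = fact (N + 1)" using f by (simp add: algebra_simps)
  finally show ?thesis by (simp add: r_def v_def)
qed

subsection \<open>A Chebyshev bound for the product of the odd primes\<close>

lemma prod_primes_dvd:
  fixes N :: nat
  assumes "finite S" "\<And>p. p \<in> S \<Longrightarrow> prime p" "\<And>p. p \<in> S \<Longrightarrow> p dvd N"
  shows "\<Prod>S dvd N"
  using assms
proof (induction S rule: finite_induct)
  case (insert p S)
  then obtain k where k: "N = \<Prod>S * k" by auto
  have p: "prime p" using insert.prems by blast
  have "\<not> p dvd q" if "q \<in> S" for q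
    using primes_dvd_imp_eq [OF p, of q] insert.prems(1) [of q] that insert.hyps by auto
  then have "\<not> p dvd \<Prod>S"
    using p insert.hyps by (simp add: prime_dvd_prod_iff)
  then have "p dvd k"
    using insert.prems(2) [of p] p unfolding k by (auto simp: prime_dvd_mult_iff)
  then show ?case
    using insert.hyps unfolding k by (auto simp: mult_ac)
qed simp

text \<open>
  All primes in \<open>(n, 6n]\<close> divide \<open>(6n)! / ((3n)! (2n)! n!)\<close>.  The resulting constant
  \<open>432\<^bsup>1/5\<^esup> \<approx> 3.37\<close> is needed: the weaker constant 4 that central binomial
  coefficients give is exactly the borderline case for the product of \<open>l\<close> consecutive odd numbers
  starting near \<open>2l\<close>.
\<close>

definition trinomial :: "nat \<Rightarrow> nat" where
  "trinomial n = fact (6 * n) div (fact (3 * n) * fact (2 * n) * fact n)"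

lemma trinomial: "trinomial n * (fact (3 * n) * fact (2 * n) * fact n) = fact (6 * n)"
proof -
  have "fact (3 * n) * fact (2 * n) * fact n dvd (fact (3 * n + 2 * n) * fact n :: nat)"
    by (intro mult_dvd_mono fact_fact_dvd_fact) simp
  also have "\<dots> dvd fact (3 * n + 2 * n + n)"
    by (rule fact_fact_dvd_fact)
  finally show ?thesis
    by (simp add: trinomial_def)
qed

text \<open>With \<open>Q = 6 * n div p\<close>, one step of the recursion for each factorial leaves
  a surplus of Q - Q div 2 - Q div 3 > 0. The multiplicities of the remaining factorials cannot
  cancel it, because (Q div 2)! (Q div 3)! divides Q!.\<close>

lemma prime_dvd_trinomial:
  assumes p: "prime p" "n < p" "p \<le> 6 * n"
  shows "p dvd trinomial n"
proof -
  define Q where "Q = 6 * n div p"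
  have a: "3 * n div p = Q div 2"
  proof -
    have "Q div 2 = 6 * n div 2 div p"
      unfolding Q_def by (simp only: div_mult2_eq [symmetric] mult.commute [of p])
    then show ?thesis by simp
  qed
  have b: "2 * n div p = Q div 3"
  proof -
    have "Q div 3 = 6 * n div 3 div p"
      unfolding Q_def by (simp only: div_mult2_eq [symmetric] mult.commute [of p])
    then show ?thesis by simp
  qed
  have p0: "p > 0" using p(2) by simp
  have "1 \<le> Q" unfolding Q_def using p p0 by (simp add: Suc_le_eq div_greater_zero_iff)
  moreover have "Q < 6" unfolding Q_def using p by (simp add: less_mult_imp_div_less)
  ultimately have Q: "Q div 2 + Q div 3 < Q" by presburger
  let ?v = "\<lambda>k. multiplicity p (fact k :: nat)"
  have pe: "prime_elem p" using p(1) by simp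
  have "fact (Q div 2) * fact (Q div 3) dvd (fact (Q div 2 + Q div 3) :: nat)"
    by (rule fact_fact_dvd_fact)
  also have "\<dots> dvd fact Q"
    using Q by (intro fact_dvd) simp
  finally have "multiplicity p (fact (Q div 2) * fact (Q div 3) :: nat) \<le> ?v Q"
    by (intro dvd_imp_multiplicity_le) auto
  then have "?v (Q div 2) + ?v (Q div 3) \<le> ?v Q"
    using pe by (simp add: prime_elem_multiplicity_mult_distrib)
  moreover have "?v (6 * n) = Q + ?v Q" "?v (3 * n) = Q div 2 + ?v (Q div 2)"
    "?v (2 * n) = Q div 3 + ?v (Q div 3)" "?v n = 0"
    using multiplicity_fact_rec [OF p(1), of "6 * n"] multiplicity_fact_rec [OF p(1), of "3 * n"]
      multiplicity_fact_rec [OF p(1), of "2 * n"] multiplicity_fact_rec [OF p(1), of n] p(2)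
    unfolding a b Q_def [symmetric] by simp_all
  ultimately have "?v (3 * n) + ?v (2 * n) + ?v n < ?v (6 * n)"
    using Q by simp
  moreover have "trinomial n \<noteq> 0"
    using trinomial [of n] by (intro notI) simp
  then have "multiplicity p (trinomial n * (fact (3 * n) * fact (2 * n) * fact n)) =
      multiplicity p (trinomial n) + (?v (3 * n) + ?v (2 * n) + ?v n)"
    using pe by (simp add: prime_elem_multiplicity_mult_distrib)
  then have "?v (6 * n) = multiplicity p (trinomial n) + (?v (3 * n) + ?v (2 * n) + ?v n)"
    by (simp only: trinomial)
  ultimately have "multiplicity p (trinomial n) \<noteq> 0" by simp
  then show ?thesis using not_dvd_imp_multiplicity_0 [of p "trinomial n"] by auto
qed

text \<open>The quotient of consecutive values is 12 (6n+1)(6n+5) / (n+1)^2, which tends to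
  432.\<close>

lemma trinomial_Suc:
  "trinomial (Suc n) * (n + 1)\<^sup>2 = trinomial n * (12 * (36 * n * (n + 1) + 5))"
proof -
  define D where "D = (fact (3 * n) * fact (2 * n) * fact n :: nat)"
  define K where "K = (3*n+1) * (3*n+2) * (3*n+3) * (2*n+1) * (2*n+2) * (n+1)"
  define L where "L = (6*n+1) * (6*n+2) * (6*n+3) * (6*n+4) * (6*n+5) * (6*n+6)"
  define Z where "Z = 12 * (36 * n * (n + 1) + 5)"
  have e: "6 * Suc n = Suc (Suc (Suc (Suc (Suc (Suc (6 * n))))))" "3 * Suc n = Suc (Suc (Suc (3 * n)))"
    "2 * Suc n = Suc (Suc (2 * n))" by simp_all
  have "fact (Suc (Suc (Suc (Suc (Suc (Suc k)))))) =
      fact k * ((k+1) * (k+2) * (k+3) * (k+4) * (k+5) * (k+6))" for k :: nat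
    unfolding fact_Suc of_nat_id unfolding Suc_eq_plus1
    by (simp only: add.assoc one_add_one numeral_plus_one arith_simps mult_ac)
  then have f6: "fact (6 * Suc n) = fact (6 * n) * L"
    unfolding e L_def by blast
  have "fact (Suc (Suc (Suc k))) = fact k * ((k+1) * (k+2) * (k+3))"
    "fact (Suc (Suc k)) = fact k * ((k+1) * (k+2))" "fact (Suc k) = fact k * (k+1)" for k :: nat
    unfolding fact_Suc of_nat_id unfolding Suc_eq_plus1
    by (simp_all only: add.assoc one_add_one numeral_plus_one arith_simps mult_ac)
  note fact_add = this
  have fD: "fact (3 * Suc n) * fact (2 * Suc n) * fact (Suc n) = D * K"
    unfolding e fact_add(1) [of "3 * n"] fact_add(2) [of "2 * n"] fact_add(3) [of n] D_def K_def
    by (simp only: mult_ac)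
  have "D * (trinomial (Suc n) * K) = D * (trinomial n * L)"
    using trinomial [of n] trinomial [of "Suc n"] unfolding f6 fD by (simp add: D_def mult_ac)
  then have *: "trinomial (Suc n) * K = trinomial n * L"
    by (simp add: D_def)
  have KZ: "K * Z = L * (n + 1)\<^sup>2"
    unfolding K_def Z_def L_def by (simp add: algebra_simps power2_eq_square)
  have "K * (trinomial (Suc n) * (n + 1)\<^sup>2) = trinomial n * L * (n + 1)\<^sup>2"
    using * by (simp add: mult_ac)
  also have "\<dots> = K * (trinomial n * Z)"
    using KZ by (simp add: mult_ac)
  finally show ?thesis by (simp add: K_def Z_def)
qed

text \<open>The bound in \<open>trinomial_le\<close> is not inductive by itself, since
  \<open>n * trinomial n\<close> grows by the factor 432 + 60 / (n (n+1)). The additional factor 1 -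
  1/(7n) on the right-hand side absorbs the excess.\<close>

lemma trinomial_bound_aux:
  "n \<ge> 1 \<Longrightarrow> 42 * n\<^sup>2 * trinomial n + 432 ^ n \<le> 432 ^ n * (7 * n)"
proof (induction n rule: dec_induct)
  case base
  have "trinomial 1 = 60"
    by (simp add: trinomial_def fact_numeral)
  then show ?case by simp
next
  case (step n)
  let ?T = "trinomial n" and ?P = "432 ^ n :: nat"
  define X where "X = 12 * (36 * n * (n + 1) + 5)"
  have "n\<^sup>2 * (42 * (n + 1)\<^sup>2 * trinomial (Suc n) + 432 ^ Suc n)
      = 42 * n\<^sup>2 * (trinomial (Suc n) * (n + 1)\<^sup>2) + n\<^sup>2 * 432 ^ Suc n"
    by (simp only: distrib_left mult_ac)
  then have 1: "n\<^sup>2 * (42 * (n + 1)\<^sup>2 * trinomial (Suc n) + 432 ^ Suc n)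
      = (42 * n\<^sup>2 * ?T) * X + n\<^sup>2 * 432 ^ Suc n"
    unfolding trinomial_Suc X_def by (simp only: mult.assoc)
  have 2: "(42 * n\<^sup>2 * ?T) * X + ?P * X \<le> ?P * (7 * n) * X"
    using mult_right_mono [OF step.IH, of X] by (simp only: distrib_right)
  have "7 * n * X + n\<^sup>2 * 432 \<le> n\<^sup>2 * (432 * (7 * Suc n)) + X"
    by (simp add: X_def algebra_simps power2_eq_square)
  from mult_left_mono [OF this, of ?P]
  have 3: "?P * (7 * n) * X + n\<^sup>2 * 432 ^ Suc n \<le> n\<^sup>2 * (432 ^ Suc n * (7 * Suc n)) + ?P * X"
    unfolding power_Suc by (simp only: distrib_left mult_ac)
  have "n\<^sup>2 * (42 * (n + 1)\<^sup>2 * trinomial (Suc n) + 432 ^ Suc n) \<le> n\<^sup>2 * (432 ^ Suc n * (7 * Suc n))"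
    unfolding 1
  proof (rule add_le_imp_le_right [of _ "?P * X", OF order_trans [OF _ 3]])
    show "42 * n\<^sup>2 * ?T * X + n\<^sup>2 * 432 ^ Suc n + ?P * X \<le> ?P * (7 * n) * X + n\<^sup>2 * 432 ^ Suc n"
      using add_right_mono [OF 2, of "n\<^sup>2 * 432 ^ Suc n"] by (simp only: add_ac)
  qed
  then show ?case using step.hyps by simp
qed

lemma trinomial_le: "n \<ge> 1 \<Longrightarrow> 6 * n * trinomial n \<le> 432 ^ n"
proof -
  assume n: "n \<ge> 1"
  have "(7 * n) * (6 * n * trinomial n) = 42 * n\<^sup>2 * trinomial n"
    by (simp add: power2_eq_square)
  also have "\<dots> \<le> 432 ^ n * (7 * n)"
    using trinomial_bound_aux [OF n] by linarith
  also have "\<dots> = (7 * n) * 432 ^ n"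
    by simp
  finally show ?thesis
    using n by (subst (asm) mult_le_cancel1) auto
qed

definition odd_primorial :: "nat \<Rightarrow> nat" where
  "odd_primorial x = \<Prod>(odd_primes x)"

lemma odd_primorial_pos: "odd_primorial x > 0"
  unfolding odd_primorial_def by (rule prod_pos) (simp add: odd_primes_def prime_gt_0_nat)

lemma odd_primorial_mono: "x \<le> y \<Longrightarrow> odd_primorial x \<le> odd_primorial y"
  unfolding odd_primorial_def
  by (intro dvd_imp_le prod_dvd_prod_subset) (use odd_primorial_pos [of y] in \<open>auto simp: odd_primes_def odd_primorial_def\<close>)

text \<open>The gain \<open>6 * n\<close> on the left pays for rounding x/6 upwards in
  \<open>ln_odd_primorial_le\<close>.\<close>

lemma odd_primorial_6_le:
  assumes "n \<ge> 1"
  shows "odd_primorial (6 * n) * (6 * n) \<le> odd_primorial n * 432 ^ n"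
proof -
  let ?S = "odd_primes (6 * n) - odd_primes n"
  have "\<Prod>?S dvd trinomial n"
    by (rule prod_primes_dvd) (auto simp: odd_primes_def not_le intro!: prime_dvd_trinomial)
  moreover have "trinomial n > 0" using trinomial [of n] by (intro Nat.gr0I) simp
  ultimately have S: "\<Prod>?S \<le> trinomial n" by (intro dvd_imp_le)
  have "odd_primorial (6 * n) = \<Prod>?S * odd_primorial n"
    unfolding odd_primorial_def
    by (rule prod.subset_diff) (auto simp: odd_primes_def)
  also have "\<dots> * (6 * n) \<le> odd_primorial n * (6 * n * trinomial n)"
    using S by simp
  also have "\<dots> \<le> odd_primorial n * 432 ^ n"
    using trinomial_le [OF assms] by simp
  finally show ?thesis .
qed

lemma convex_on_add_mult_ln:
  fixes a b c d :: real
  assumes "0 < a" "c \<le> a"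
  shows "convex_on {a..b} (\<lambda>x. (x + c) * ln x - d * x)"
proof (rule f''_ge0_imp_convex)
  fix x assume x: "x \<in> {a..b}"
  show "((\<lambda>x. (x + c) * ln x - d * x) has_real_derivative (ln x + (x + c) / x - d)) (at x)"
    using x assms by (auto intro!: derivative_eq_intros simp: add_divide_distrib)
  have "((\<lambda>x. ln x + (x + c) / x - d) has_real_derivative 1 / x + (1 * x - (x + c) * 1) / (x * x)) (at x)"
    using x assms by (auto intro!: derivative_eq_intros)
  moreover have "1 / x + (1 * x - (x + c) * 1) / (x * x) = (x - c) / x\<^sup>2"
    using x assms by (simp add: divide_simps power2_eq_square)
  ultimately show "((\<lambda>x. ln x + (x + c) / x - d) has_real_derivative (x - c) / x\<^sup>2) (at x)"
    by simp
  show "(x - c) / x\<^sup>2 \<ge> 0" using x assms by auto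
qed simp

text \<open>The constant satisfies 127^5 < 432^4, so a bound by the fourth root of 127^x is good
  enough. By convexity only the two ends matter. The upper end is 72 = 432 / 6, the point up to
  which the induction for larger x needs a bound without the summand \<open>ln 6\<close>.\<close>

lemma add_9_mult_ln_le:
  fixes x :: real
  assumes "9 \<le> x" "x \<le> 72"
  shows "(x + 9) * ln x \<le> x * ln 127"
proof -
  let ?f = "\<lambda>x. (x + 9) * ln x - ln 127 * x"
  have "?f x \<le> max (?f 9) (?f 72)"
    using assms by (intro convex_on_le_max convex_on_add_mult_ln) auto
  moreover have "ln (9 ^ 2) \<le> ln (127 :: real)" by simp
  then have "2 * ln 9 \<le> ln (127 :: real)" by (subst (asm) ln_realpow) simp_all
  then have "?f (9 :: real) \<le> 0" by simp
  moreover have "ln (72 ^ 9) \<le> ln (127 ^ 8 :: real)" by simp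
  then have "9 * ln 72 \<le> 8 * ln (127 :: real)" by (simp only: ln_realpow)
  then have "?f (72 :: real) \<le> 0" by simp
  ultimately show ?thesis by (simp add: mult.commute)
qed

lemma ln_odd_primorial_le_small:
  assumes "x \<le> 72"
  shows "ln (real (odd_primorial x)) \<le> real x / 5 * ln 432"
proof (cases "x = 0")
  case True
  then have "odd_primes x = {}" by (auto simp: odd_primes_def dest: prime_gt_0_nat)
  then show ?thesis using True by (simp add: odd_primorial_def)
next
  case False
  have tab: "real (x + 9) * ln (real x) \<le> real x * ln 127"
  proof (cases "x < 9")
    case True
    have "\<forall>y \<in> {1, 2, 3, 4, 5, 6, 7, 8}. y ^ (y + 9) \<le> (127::nat) ^ y" by simp
    moreover have "x \<in> {1, 2, 3, 4, 5, 6, 7, 8}" using True False by auto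
    ultimately have "real (x ^ (x + 9)) \<le> real (127 ^ x)" by (metis of_nat_le_iff)
    then have "ln (real x ^ (x + 9)) \<le> ln (127 ^ x)"
      using False by (subst ln_le_cancel_iff) simp_all
    then show ?thesis using False by (simp only: ln_realpow of_nat_0_less_iff neq0_conv)
  next
    case False
    then show ?thesis using add_9_mult_ln_le [of "real x"] assms by simp
  qed
  let ?P = "odd_primorial x"
  have "?P \<le> x ^ card (odd_primes x)"
    unfolding odd_primorial_def using prod_mono [of "odd_primes x" "\<lambda>p. p" "\<lambda>_. x"]
    by (auto simp: odd_primes_def)
  then have "?P ^ 4 \<le> (x ^ card (odd_primes x)) ^ 4" by (rule power_mono) simp
  also have "\<dots> = x ^ (4 * card (odd_primes x))" by (simp add: power_mult [symmetric] mult.commute)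
  also have "\<dots> \<le> x ^ (x + 9)" using card_odd_primes_le False by (intro power_increasing) auto
  finally have "real (?P ^ 4) \<le> real (x ^ (x + 9))" by (simp only: of_nat_le_iff)
  then have "ln (real ?P ^ 4) \<le> ln (real x ^ (x + 9))"
    using odd_primorial_pos [of x] False by (subst ln_le_cancel_iff) simp_all
  then have "4 * ln (real ?P) \<le> real x * ln 127"
    using tab odd_primorial_pos [of x] False by (simp only: ln_realpow of_nat_0_less_iff neq0_conv)
  moreover have "ln (127 ^ 5) \<le> ln (432 ^ 4 :: real)" by simp
  then have "5 * ln 127 \<le> 4 * ln (432 :: real)" by (simp only: ln_realpow)
  then have "real x * (5 * ln 127) \<le> real x * (4 * ln 432)" by (rule mult_left_mono) simp
  ultimately show ?thesis by simp
qed

text \<open>Descent from x to n, which is x/6 rounded up, reproduces the slope because 1/5 = (1 +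
  1/5) / 6. The rounding costs at most \<open>ln 432\<close> and the descent gains
  \<open>ln x\<close>. For x above 432 the gain covers the cost; for x from 73 to 432 the deficit is
  at most \<open>ln 6\<close>, and n is in the range of the bound without that summand.\<close>

lemma ln_odd_primorial_le: "ln (real (odd_primorial x)) \<le> ln 6 + real x / 5 * ln 432"
proof (induction x rule: less_induct)
  case (less x)
  show ?case
  proof (cases "x \<le> 72")
    case True
    then show ?thesis using ln_odd_primorial_le_small [of x] ln_ge_zero [of 6] by linarith
  next
    case False
    define n where "n = (x + 5) div 6"
    have n: "n \<ge> 1" "n < x" "x \<le> 6 * n" "6 * n \<le> x + 5"
      using False by (auto simp: n_def)
    have "odd_primorial x * x \<le> odd_primorial (6 * n) * (6 * n)"
      by (intro mult_mono odd_primorial_mono n) auto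
    also have "\<dots> \<le> odd_primorial n * 432 ^ n" by (rule odd_primorial_6_le) fact
    finally have "real (odd_primorial x * x) \<le> real (odd_primorial n * 432 ^ n)"
      by (simp only: of_nat_le_iff)
    then have "real (odd_primorial x) * real x \<le> real (odd_primorial n) * 432 ^ n" by simp
    then have "ln (real (odd_primorial x) * real x) \<le> ln (real (odd_primorial n) * 432 ^ n)"
      using odd_primorial_pos [of x] odd_primorial_pos [of n] False by (subst ln_le_cancel_iff) auto
    then have le: "ln (real (odd_primorial x)) + ln (real x) \<le> ln (real (odd_primorial n)) + real n * ln 432"
      using odd_primorial_pos [of x] odd_primorial_pos [of n] False
      by (simp add: ln_mult ln_realpow)
    have "real (6 * n) \<le> real (x + 5)" using n by (simp only: of_nat_le_iff)
    then have n6: "real n * 6 \<le> real x + 5" by simp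
    have n_ln: "real n * 6 / 5 * L \<le> real x / 5 * L + L" if "L \<ge> 0" for L :: real
      using mult_right_mono [OF n6 that] by (simp add: algebra_simps)
    note n_ln = n_ln [of "ln 432", OF ln_ge_zero]
    show ?thesis
    proof (cases "x \<le> 432")
      case True
      then have "ln (real (odd_primorial n)) \<le> real n / 5 * ln 432"
        using n(4) by (intro ln_odd_primorial_le_small) linarith
      moreover have "ln 432 = ln (6 * 72 :: real)" by simp
      then have "ln 432 = ln 6 + ln (72 :: real)" by (subst (asm) ln_mult) simp_all
      moreover have "ln 72 \<le> ln (real x)" using False by simp
      ultimately show ?thesis using le n_ln by simp
    next
      case False
      then have "ln 432 \<le> ln (real x)" by simp
      with less.IH [OF n(2)] show ?thesis using le n_ln by simp
    qed
  qed
qed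

subsection \<open>Consecutive odd numbers without a large prime factor\<close>

text \<open>For \<open>j\<close> other than \<open>i\<close> the power of \<open>p\<close> in term
  \<open>j\<close> also divides term \<open>i\<close>, hence the difference 2|i - j|, and
  \<open>p\<close> is odd. Multiplying the numbers |i - j| gives i! (l-1-i)!, a divisor of
  (l-1)!.\<close>

lemma multiplicity_prod_le_fact:
  fixes p m l i :: nat
  assumes p: "prime p" "odd p" and m: "odd m" and i: "i < l"
    and max: "\<And>j. j < l \<Longrightarrow> multiplicity p (m + 2 * j) \<le> multiplicity p (m + 2 * i)"
  shows "multiplicity p (\<Prod>j<l. m + 2 * j) \<le>
    multiplicity p (m + 2 * i) + multiplicity p (fact (l - 1) :: nat)"
proof -
  have pe: "prime_elem p" using p(1) by simp
  have m0: "m > 0" using m by (auto intro: Nat.gr0I)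
  let ?v = "\<lambda>j. multiplicity p (m + 2 * j)"
  have le: "?v j \<le> multiplicity p (if j < i then i - j else j - i)" if j: "j < l" "j \<noteq> i" for j
  proof -
    define d where "d = (if j < i then i - j else j - i)"
    have "p ^ ?v j dvd m + 2 * i" using max [OF j(1)] by (rule multiplicity_dvd')
    moreover have "p ^ ?v j dvd m + 2 * j" by (rule multiplicity_dvd)
    ultimately have "p ^ ?v j dvd (m + 2 * i) - (m + 2 * j)" "p ^ ?v j dvd (m + 2 * j) - (m + 2 * i)"
      by (simp_all only: dvd_diff_nat)
    then have "p ^ ?v j dvd 2 * d" by (auto simp: d_def diff_mult_distrib2)
    moreover have "2 * d \<noteq> 0" using j by (auto simp: d_def)
    ultimately have "?v j \<le> multiplicity p (2 * d)"
      using p(1) by (intro multiplicity_geI) auto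
    also have "multiplicity p (2 * d) = multiplicity p 2 + multiplicity p d"
      using pe \<open>2 * d \<noteq> 0\<close> by (subst prime_elem_multiplicity_mult_distrib) auto
    also have "multiplicity p 2 = 0"
      using primes_dvd_imp_eq [OF p(1) two_is_prime_nat] p(2)
      by (intro not_dvd_imp_multiplicity_0) auto
    finally show ?thesis by (simp add: d_def)
  qed
  have f1: "(\<Prod>j<i. i - j) = fact i"
    by (simp add: fact_prod_rev atLeast0LessThan)
  have f2: "(\<Prod>j\<in>{i<..<l}. j - i) = fact (l - 1 - i)"
    unfolding fact_prod of_nat_id
    by (rule prod.reindex_bij_witness [of _ "\<lambda>j. j + i" "\<lambda>j. j - i"]) auto
  have "multiplicity p (\<Prod>j<l. m + 2 * j) = (\<Sum>j<l. ?v j)"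
    using pe m0 by (intro prime_elem_multiplicity_prod_distrib) auto
  also have "\<dots> = ?v i + (\<Sum>j\<in>{..<l} - {i}. ?v j)"
    using i by (intro sum.remove) auto
  also have "(\<Sum>j\<in>{..<l} - {i}. ?v j) \<le>
      (\<Sum>j\<in>{..<l} - {i}. multiplicity p (if j < i then i - j else j - i))"
    by (intro sum_mono le) auto
  also have "{..<l} - {i} = {..<i} \<union> {i<..<l}" using i by auto
  also have "(\<Sum>j\<in>{..<i} \<union> {i<..<l}. multiplicity p (if j < i then i - j else j - i)) =
      (\<Sum>j<i. multiplicity p (i - j)) + (\<Sum>j\<in>{i<..<l}. multiplicity p (j - i))"
    by (subst sum.union_disjoint) (auto intro!: arg_cong2 [of _ _ _ _ "(+)"] sum.cong)
  also have "(\<Sum>j<i. multiplicity p (i - j)) = multiplicity p (fact i)"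
    unfolding f1 [symmetric] using pe by (intro prime_elem_multiplicity_prod_distrib [symmetric]) auto
  also have "(\<Sum>j\<in>{i<..<l}. multiplicity p (j - i)) = multiplicity p (fact (l - 1 - i))"
    unfolding f2 [symmetric] using pe by (intro prime_elem_multiplicity_prod_distrib [symmetric]) auto
  also have "multiplicity p (fact i) + multiplicity p (fact (l - 1 - i)) =
      multiplicity p (fact i * fact (l - 1 - i) :: nat)"
    using pe by (subst prime_elem_multiplicity_mult_distrib) auto
  also have "\<dots> \<le> multiplicity p (fact (l - 1))"
    using fact_fact_dvd_fact [of i "l - 1 - i"] i by (intro dvd_imp_multiplicity_le) auto
  finally show ?thesis by simp
qed

definition odd_fact :: "nat \<Rightarrow> nat" where
  "odd_fact k = fact k div 2 ^ multiplicity 2 (fact k :: nat)"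

lemma fact_eq_odd_fact: "fact k = 2 ^ multiplicity 2 (fact k :: nat) * odd_fact k"
  unfolding odd_fact_def by (simp add: multiplicity_dvd)

text \<open>\<open>e p\<close> is the highest multiplicity of \<open>p\<close> in a single term. The
  second conjunct separates the primes above the square root of the last term, which enter at most
  once; long runs depend on it.\<close>

lemma smooth_odd_run_bound:
  fixes m l :: nat
  assumes m: "odd m" and l: "l \<ge> 1"
    and smooth: "\<forall>p i. prime p \<and> i < l \<and> p dvd m + 2 * i \<longrightarrow> p \<le> 2 * l - 1"
  shows "\<exists>e. (\<forall>p\<in>odd_primes (2 * l - 1). p ^ e p \<le> m + 2 * (l - 1)) \<and>
    (\<forall>p\<in>odd_primes (2 * l - 1). m + 2 * (l - 1) < p * p \<longrightarrow> p ^ e p \<le> p) \<and>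
    (\<Prod>j<l. m + 2 * j) \<le> odd_fact (l - 1) * (\<Prod>p\<in>odd_primes (2 * l - 1). p ^ e p)"
proof -
  have m0: "m > 0" using m by (auto intro: Nat.gr0I)
  have "\<exists>i<l. \<forall>j<l. multiplicity p (m + 2 * j) \<le> multiplicity p (m + 2 * i)" for p
  proof -
    let ?A = "(\<lambda>j. multiplicity p (m + 2 * j)) ` {..<l}"
    have "{..<l} \<noteq> {}" using l lessThan_empty_iff [of l] by simp
    then have "Max ?A \<in> ?A" by (intro Max_in) auto
    then obtain i where "i < l" "Max ?A = multiplicity p (m + 2 * i)" by auto
    then show ?thesis by (metis Max_ge finite_imageI finite_lessThan image_eqI lessThan_iff)
  qed
  then obtain i where i: "\<And>p. i p < l"
      "\<And>p j. j < l \<Longrightarrow> multiplicity p (m + 2 * j) \<le> multiplicity p (m + 2 * i p)"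
    by metis
  define e where "e p = multiplicity p (m + 2 * i p)" for p
  have e_le: "p ^ e p \<le> m + 2 * (l - 1)" for p
  proof -
    have "p ^ e p \<le> m + 2 * i p" unfolding e_def using m0 by (intro dvd_imp_le multiplicity_dvd) auto
    also have "\<dots> \<le> m + 2 * (l - 1)" using i(1) [of p] by auto
    finally show ?thesis .
  qed
  show ?thesis
  proof (intro exI [of _ e] conjI ballI impI)
    show "p ^ e p \<le> m + 2 * (l - 1)" for p by (rule e_le)
  next
    fix p assume p: "p \<in> odd_primes (2 * l - 1)" "m + 2 * (l - 1) < p * p"
    then have p1: "p > 1" by (auto simp: odd_primes_def dest: prime_gt_1_nat)
    have "e p \<le> 1"
    proof (rule ccontr)
      assume "\<not> e p \<le> 1"
      then have "p ^ 2 \<le> p ^ e p" using p1 by (intro power_increasing) auto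
      with e_le [of p] p(2) show False by (simp add: power2_eq_square)
    qed
    then show "p ^ e p \<le> p"
      using p1 power_increasing [of "e p" 1 p] by simp
  next
    let ?P = "\<Prod>j<l. m + 2 * j" and ?Q = "\<Prod>p\<in>odd_primes (2 * l - 1). p ^ e p"
    have P0: "?P \<noteq> 0" using m0 by simp
    have Qpos: "?Q > 0" by (rule prod_pos) (auto simp: odd_primes_def dest: prime_gt_0_nat)
    from this have Q0: "?Q \<noteq> 0" by (rule gr_implies_not0)
    have O0: "odd_fact (l - 1) \<noteq> 0" using fact_eq_odd_fact [of "l - 1"] by (intro notI) simp
    have "?P dvd odd_fact (l - 1) * ?Q"
    proof (rule multiplicity_le_imp_dvd [OF P0])
      fix p :: nat assume p: "prime p"
      have pe: "prime_elem p" using p by simp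
      show "multiplicity p ?P \<le> multiplicity p (odd_fact (l - 1) * ?Q)"
      proof (cases "p dvd ?P")
        case False
        then show ?thesis by (simp add: not_dvd_imp_multiplicity_0)
      next
        case True
        then obtain j where j: "j < l" "p dvd m + 2 * j"
          using p by (auto simp: prime_dvd_prod_iff)
        then have odd: "odd p" and ple: "p \<le> 2 * l - 1"
          using m smooth p j dvd_trans [of 2 p "m + 2 * j"] by auto
        have "p ^ e p dvd ?Q"
          using p odd ple by (intro dvd_prodI) (auto simp: odd_primes_def)
        then have eQ: "e p \<le> multiplicity p ?Q"
          using Q0 p by (intro multiplicity_geI) auto
        have "multiplicity p (fact (l - 1) :: nat) =
            multiplicity p (2 ^ multiplicity 2 (fact (l - 1) :: nat) :: nat) + multiplicity p (odd_fact (l - 1))"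
          using O0 pe by (subst fact_eq_odd_fact, subst prime_elem_multiplicity_mult_distrib) auto
        also have "multiplicity p (2 ^ multiplicity 2 (fact (l - 1) :: nat) :: nat) = 0"
        proof (rule not_dvd_imp_multiplicity_0, rule notI)
          assume "p dvd 2 ^ multiplicity 2 (fact (l - 1) :: nat)"
          then have "p dvd 2" by (rule prime_dvd_power [OF p])
          with odd show False using primes_dvd_imp_eq [OF p two_is_prime_nat] by simp
        qed
        finally have vO: "multiplicity p (odd_fact (l - 1)) = multiplicity p (fact (l - 1) :: nat)" by simp
        have "multiplicity p ?P \<le> e p + multiplicity p (fact (l - 1) :: nat)"
          unfolding e_def by (rule multiplicity_prod_le_fact) (use p odd m i in auto)
        also have "\<dots> \<le> multiplicity p (odd_fact (l - 1)) + multiplicity p ?Q"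
          using eQ vO by simp
        also have "\<dots> = multiplicity p (odd_fact (l - 1) * ?Q)"
          using O0 Q0 pe by (simp add: prime_elem_multiplicity_mult_distrib)
        finally show ?thesis .
      qed
    qed
    then show "?P \<le> odd_fact (l - 1) * ?Q"
      using O0 Qpos by (intro dvd_imp_le) simp_all
  qed
qed

text \<open>Each ratio of a term to the last term increases with \<open>m\<close>, so the comparison
  is with the smallest admissible start \<open>2 * l - 1\<close>, whose last term is
  \<open>4 * l - 3\<close>.\<close>

lemma odd_run_ge:
  fixes m l :: nat
  assumes m: "m \<ge> 2 * l - 1" and l: "l \<ge> 1"
  shows "(\<Prod>j<l. 2 * l - 1 + 2 * j) * (m + 2 * (l - 1)) ^ l \<le> (4 * l - 3) ^ l * (\<Prod>j<l. m + 2 * j)"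
proof -
  have "(2 * l - 1 + 2 * j) * (m + 2 * (l - 1)) \<le> (4 * l - 3) * (m + 2 * j)" if "j < l" for j
  proof -
    obtain c where c: "m = 2 * l - 1 + c" using m le_Suc_ex by blast
    obtain r where r: "l = Suc (j + r)" using less_imp_Suc_add [OF \<open>j < l\<close>] by blast
    show ?thesis unfolding c r by (simp add: algebra_simps)
  qed
  then have "(\<Prod>j<l. (2 * l - 1 + 2 * j) * (m + 2 * (l - 1))) \<le> (\<Prod>j<l. (4 * l - 3) * (m + 2 * j))"
    by (intro prod_mono) auto
  then show ?thesis by (simp add: prod.distrib)
qed

text \<open>Passing from \<open>l\<close> to \<open>Suc l\<close> replaces the factor 2l-1 by
  (4l-1)(4l+1), a gain of at least 8l.\<close>

lemma first_run_ge: "l \<ge> 1 \<Longrightarrow> 8 ^ (l - 1) * fact (l - 1) \<le> (\<Prod>j<l. 2 * l - 1 + 2 * j)"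
proof (induction l rule: dec_induct)
  case base
  then show ?case by simp
next
  case (step l)
  obtain k where k: "l = Suc k" using step.hyps by (cases l) auto
  let ?R = "\<Prod>j<l. 2 * l - 1 + 2 * j"
  have "(2 * l - 1) * (\<Prod>j<Suc l. 2 * Suc l - 1 + 2 * j) =
      (2 * l - 1) * (\<Prod>j<k. 2 * l + 1 + 2 * j) * ((4 * l - 1) * (4 * l + 1))"
    by (simp add: k algebra_simps)
  also have "(2 * l - 1) * (\<Prod>j<k. 2 * l + 1 + 2 * j) = ?R"
    unfolding k by (subst prod.lessThan_Suc_shift) (simp add: algebra_simps)
  finally have eq: "(2 * l - 1) * (\<Prod>j<Suc l. 2 * Suc l - 1 + 2 * j) = ?R * ((4 * l - 1) * (4 * l + 1))" .
  have "(2 * l - 1) * (8 ^ l * fact l) = (8 ^ (l - 1) * fact (l - 1)) * (8 * l * (2 * l - 1))"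
    by (simp add: k algebra_simps)
  also have "\<dots> \<le> ?R * ((4 * l - 1) * (4 * l + 1))"
  proof (rule mult_mono [OF step.IH])
    show "8 * l * (2 * l - 1) \<le> (4 * l - 1) * (4 * l + 1)" by (simp add: k algebra_simps)
  qed simp_all
  also note eq [symmetric]
  finally have "8 ^ l * fact l \<le> (\<Prod>j<Suc l. 2 * Suc l - 1 + 2 * j)"
    by (rule mult_left_le_imp_le) (simp add: k)
  then show ?case by simp
qed

text \<open>The last conjunct is the closed form: 16 = 8 * 2 joins the 8 of
  \<open>first_run_ge\<close> to the 2 saved by passing to the odd part of (l-1)!. Short runs use
  the sharper third conjunct.\<close>

lemma smooth_odd_run:
  fixes m l :: nat
  assumes m: "odd m" "m \<ge> 2 * l - 1" and l: "l \<ge> 1"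
    and smooth: "\<forall>p i. prime p \<and> i < l \<and> p dvd m + 2 * i \<longrightarrow> p \<le> 2 * l - 1"
  shows "\<exists>q. (\<forall>p\<in>odd_primes (2 * l - 1). q p \<le> m + 2 * (l - 1)) \<and>
    (\<forall>p\<in>odd_primes (2 * l - 1). m + 2 * (l - 1) < p * p \<longrightarrow> q p \<le> p) \<and>
    (\<Prod>j<l. 2 * l - 1 + 2 * j) * (m + 2 * (l - 1)) ^ l \<le>
       (4 * l - 3) ^ l * odd_fact (l - 1) * prod q (odd_primes (2 * l - 1)) \<and>
    16 ^ (l - 1) * (m + 2 * (l - 1)) ^ l \<le> (4 * l - 3) ^ l * l * prod q (odd_primes (2 * l - 1))"
proof -
  obtain e where e:
    "\<forall>p\<in>odd_primes (2 * l - 1). p ^ e p \<le> m + 2 * (l - 1)"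
    "\<forall>p\<in>odd_primes (2 * l - 1). m + 2 * (l - 1) < p * p \<longrightarrow> p ^ e p \<le> p"
    "(\<Prod>j<l. m + 2 * j) \<le> odd_fact (l - 1) * (\<Prod>p\<in>odd_primes (2 * l - 1). p ^ e p)"
    using smooth_odd_run_bound [OF m(1) l smooth] by blast
  define q where "q p = p ^ e p" for p
  let ?Q = "prod q (odd_primes (2 * l - 1))" and ?R = "\<Prod>j<l. 2 * l - 1 + 2 * j"
    and ?M = "m + 2 * (l - 1)"
  have "?R * ?M ^ l \<le> (4 * l - 3) ^ l * (\<Prod>j<l. m + 2 * j)"
    using m l by (intro odd_run_ge)
  also have "\<dots> \<le> (4 * l - 3) ^ l * (odd_fact (l - 1) * ?Q)"
    using e(3) unfolding q_def by (intro mult_left_mono) auto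
  finally have exact: "?R * ?M ^ l \<le> (4 * l - 3) ^ l * odd_fact (l - 1) * ?Q"
    by (simp only: mult.assoc)
  have odd_fact: "2 ^ (l - 1) * odd_fact (l - 1) \<le> l * fact (l - 1)"
    using odd_part_fact_le [of "l - 1"] l by (cases l) (simp_all add: odd_fact_def)
  have "16 ^ (l - 1) = 2 ^ (l - 1) * (8 :: nat) ^ (l - 1)" by (simp flip: power_mult_distrib)
  then have "fact (l - 1) * (16 ^ (l - 1) * ?M ^ l) = 2 ^ (l - 1) * (8 ^ (l - 1) * fact (l - 1) * ?M ^ l)"
    by (simp only: mult_ac)
  also have "\<dots> \<le> 2 ^ (l - 1) * (?R * ?M ^ l)"
    using first_run_ge [OF l] by (intro mult_mono) auto
  also have "\<dots> \<le> 2 ^ (l - 1) * ((4 * l - 3) ^ l * odd_fact (l - 1) * ?Q)"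
    using exact by (intro mult_left_mono) auto
  also have "\<dots> = 2 ^ (l - 1) * odd_fact (l - 1) * ((4 * l - 3) ^ l * ?Q)"
    by (simp only: mult_ac)
  also have "\<dots> \<le> l * fact (l - 1) * ((4 * l - 3) ^ l * ?Q)"
    using odd_fact by (intro mult_right_mono) auto
  also have "\<dots> = fact (l - 1) * ((4 * l - 3) ^ l * l * ?Q)"
    by (simp only: mult_ac)
  finally have "16 ^ (l - 1) * ?M ^ l \<le> (4 * l - 3) ^ l * l * ?Q"
    by (rule mult_left_le_imp_le) simp
  then show ?thesis
    using e exact by (intro exI [of _ q]) (simp add: q_def)
qed

lemma prod_le_power_card:
  fixes q :: "nat \<Rightarrow> nat"
  assumes "finite A" "\<And>p. p \<in> A \<Longrightarrow> q p \<le> M" "card A \<le> c" "M > 0"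
  shows "prod q A \<le> M ^ c"
proof -
  have "prod q A \<le> M ^ card A"
    using prod_mono [of A q "\<lambda>_. M"] assms by simp
  also have "\<dots> \<le> M ^ c" using assms by (intro power_increasing) auto
  finally show ?thesis .
qed

text \<open>Once fewer factors \<open>M\<close> stand on the right than on the left,
  \<open>M\<close> may be replaced by any lower bound for it.\<close>

lemma cancel_power_le:
  fixes R M N B c l :: nat
  assumes "R * M ^ l \<le> N * M ^ c" "c \<le> l" "B \<le> M" "M > 0"
  shows "R * B ^ (l - c) \<le> N"
proof -
  have "M ^ l = M ^ (l - c) * M ^ c" using assms(2) by (simp flip: power_add)
  then have "R * M ^ (l - c) * M ^ c \<le> N * M ^ c"
    using assms(1) by (simp only: mult.assoc)
  then have "R * M ^ (l - c) \<le> N" using assms(4) by (simp del: mult_le_cancel2 add: mult_le_cancel2)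
  moreover have "R * B ^ (l - c) \<le> R * M ^ (l - c)"
    using assms(3) by (intro mult_left_mono power_mono) auto
  ultimately show ?thesis by linarith
qed

section \<open>Runs of two to eight terms\<close>

lemma odd_fact_eq:
  assumes "fact k = 2 ^ a * r" "odd r"
  shows "odd_fact k = (r :: nat)"
proof -
  have "r \<noteq> 0" using assms(2) by (intro notI) simp
  then have "multiplicity 2 (2 ^ a * r) = a + multiplicity 2 r"
    by (subst prime_elem_multiplicity_mult_distrib) auto
  also have "multiplicity 2 r = 0" using assms(2) by (rule not_dvd_imp_multiplicity_0)
  finally show ?thesis unfolding odd_fact_def assms(1) by simp
qed

lemma odd_primes_subset: "x \<le> 15 \<Longrightarrow> odd_primes x \<subseteq> set (filter (\<lambda>p. p \<le> x) [3, 5, 7, 11, 13])"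
proof
  fix p assume x: "x \<le> 15" and "p \<in> odd_primes x"
  then have p: "prime p" "odd p" "p \<le> x" by (auto simp: odd_primes_def)
  have "p \<noteq> 9" "p \<noteq> 15" "p \<noteq> 1"
    using p(1) by (auto simp: prime_nat_numeral_eq intro: notI)
  moreover have "p \<in> {1, 3, 5, 7, 9, 11, 13, 15}"
    using p(2,3) x by (auto elim!: oddE)
  ultimately show "p \<in> set (filter (\<lambda>p. p \<le> x) [3, 5, 7, 11, 13])"
    using p(3) by auto
qed

lemma smooth_odd_run_small:
  fixes m l :: nat
  assumes m: "odd m" "m \<ge> 2 * l - 1" and l: "2 \<le> l" "l \<le> 8"
    and smooth: "\<forall>p i. prime p \<and> i < l \<and> p dvd m + 2 * i \<longrightarrow> p \<le> 2 * l - 1"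
  shows False
proof -
  define B where "B = 4 * l - 3"
  define R where "R = (\<Prod>j<l. 2 * l - 1 + 2 * j)"
  define M where "M = m + 2 * (l - 1)"
  obtain q where q:
    "\<forall>p\<in>odd_primes (2 * l - 1). q p \<le> m + 2 * (l - 1)"
    "(\<Prod>j<l. 2 * l - 1 + 2 * j) * (m + 2 * (l - 1)) ^ l \<le>
       (4 * l - 3) ^ l * odd_fact (l - 1) * prod q (odd_primes (2 * l - 1))"
    using smooth_odd_run [OF m _ smooth] l by auto
  have M: "M \<ge> B" "M > 0" using m l by (auto simp: M_def B_def)
  have le: "R * B ^ (l - c) \<le> B ^ l * odd_fact (l - 1)"
    if c: "card (odd_primes (2 * l - 1)) \<le> c" "c \<le> l" for c
  proof (rule cancel_power_le)
    have "R * M ^ l \<le> B ^ l * odd_fact (l - 1) * prod q (odd_primes (2 * l - 1))"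
      using q(2) by (simp add: R_def M_def B_def)
    also have "\<dots> \<le> B ^ l * odd_fact (l - 1) * M ^ c"
      using q(1) c M by (intro mult_left_mono prod_le_power_card) (auto simp: M_def)
    finally show "R * M ^ l \<le> B ^ l * odd_fact (l - 1) * M ^ c" .
  qed (use M c in auto)
  have card: "card (odd_primes (2 * l - 1)) \<le> card (set (filter (\<lambda>p. p \<le> 2 * l - 1) [3, 5, 7, 11, 13]))"
    using l by (intro card_mono odd_primes_subset) auto
  have f: "odd_fact 1 = 1" "odd_fact 2 = 1" "odd_fact 3 = 3" "odd_fact 4 = 3" "odd_fact 5 = 15"
    "odd_fact 6 = 45" "odd_fact 7 = 315"
    by (rule odd_fact_eq [of _ 0] odd_fact_eq [of _ 1] odd_fact_eq [of _ 3] odd_fact_eq [of _ 4],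
        simp add: fact_numeral, simp)+
  \<comment> \<open>\<open>M\<close> has dropped out of \<open>le\<close>; for each \<open>l\<close>
    a false inequality between numerals remains.\<close>
  have "l \<in> {2, 3, 4, 5, 6, 7, 8}" using l by auto
  then show False
    using le [of "card (set (filter (\<lambda>p. p \<le> 2 * l - 1) [3::nat, 5, 7, 11, 13]))"] card f
    by (auto simp: R_def B_def lessThan_nat_numeral)
qed

section \<open>Runs of nine to 255 terms\<close>

lemma prime_natI:
  fixes p :: nat
  assumes "p > 1" "\<And>d. prime d \<Longrightarrow> d < p \<Longrightarrow> d * d \<le> p \<Longrightarrow> \<not> d dvd p"
  shows "prime p"
proof (rule ccontr)
  assume "\<not> prime p"
  then obtain a where a: "a dvd p" "a \<noteq> 1" "a \<noteq> p"
    using assms(1) by (auto simp: prime_nat_iff)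
  then obtain b where b: "p = a * b" by blast
  have ab: "a \<noteq> 1" "b \<noteq> 1" "0 < a" "0 < b"
    using a b assms(1) by (auto intro: Nat.gr0I)
  obtain d e where d: "prime d" "d dvd a" and e: "prime e" "e dvd b"
    using prime_factor_nat ab(1,2) by metis
  have "d \<le> a" "e \<le> b" using d e ab by (auto intro: dvd_imp_le)
  then have "d * e \<le> p" unfolding b by (rule mult_mono) simp_all
  moreover have "1 < d" "1 < e" using d e prime_gt_1_nat by blast+
  moreover from this have "d < d * e" "e < d * e" by simp_all
  ultimately have lt: "d < p" "e < p" by linarith+
  show False
  proof (cases "d \<le> e")
    case True
    then have "d * d \<le> p" using \<open>d * e \<le> p\<close> mult_le_mono2 [OF True, of d] by linarith
    moreover have "d dvd p" using d b by simp
    ultimately show False using assms(2) d lt by blast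
  next
    case False
    then have "e * e \<le> p" using \<open>d * e \<le> p\<close> mult_le_mono1 [of e d e] by linarith
    moreover have "e dvd p" using e b by simp
    ultimately show False using assms(2) e lt by blast
  qed
qed

text \<open>
  For \<open>9 \<le> l < 256\<close> and \<open>m\<close> not much larger than \<open>2l\<close>, one of the numbers is itself a
  prime; this is witnessed by a chain of primes without large gaps.
\<close>

definition small_primes :: "nat list" where
  "small_primes = [2, 3, 5, 7, 11, 13, 17, 19, 23, 29, 31, 37, 41, 43, 47, 53, 59, 61, 67, 71, 73, 79, 83]"

lemma small_primes:
  assumes "prime d" "d < 88"
  shows "d \<in> set small_primes"
proof -
  have "list_all (\<lambda>d. d \<in> set small_primes \<or> list_ex (\<lambda>e. e < d \<and> e dvd d) [2, 3, 5, 7]) [2..<88]"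
    unfolding small_primes_def by simp
  moreover have "d \<in> set [2..<88]"
    unfolding set_upt using assms prime_ge_2_nat by simp
  ultimately have "d \<in> set small_primes \<or> list_ex (\<lambda>e. e < d \<and> e dvd d) [2, 3, 5, 7]"
    unfolding list_all_iff by (rule bspec)
  moreover have "\<not> (e < d \<and> e dvd d)" if "e \<ge> 2" for e
  proof
    assume "e < d \<and> e dvd d"
    moreover from this have "e = 1 \<or> e = d"
      using assms(1) unfolding prime_nat_iff by blast
    ultimately show False using that by linarith
  qed
  then have "\<not> list_ex (\<lambda>e. e < d \<and> e dvd d) [2, 3, 5, 7]"
    unfolding list_ex_iff by simp
  ultimately show ?thesis by blast
qed

definition prime_chain :: "nat list" where
  "prime_chain = [17, 31, 47, 61, 73, 89, 103, 113, 127, 139, 151, 167, 181, 197, 211, 227, 241, 257, 271,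
      283, 293, 313, 331, 353, 373, 397, 421, 449, 479, 509, 541, 577, 613, 653, 691, 733, 773,
      823, 877, 929, 991, 1051, 1117, 1187, 1259, 1327, 1409, 1499, 1597, 1699, 1811, 1931,
      2053, 2179, 2311, 2459, 2621, 2791, 2971, 3169, 3373, 3593, 3833, 4079, 4349, 4639, 4943,
      5273, 5623, 5987, 6379, 6803, 7253, 7727]"

text \<open>All members are below 88^2, so trial division by the primes below 88 suffices.\<close>

lemma prime_chain_prime: "p \<in> set prime_chain \<Longrightarrow> prime p"
proof -
  assume p: "p \<in> set prime_chain"
  have "list_all (\<lambda>p. 1 < p \<and> p < 88 * 88 \<and> list_all (\<lambda>d. p = d \<or> p mod d \<noteq> 0) small_primes) prime_chain"
    unfolding prime_chain_def small_primes_def by simp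
  with p have *: "1 < p" "p < 88 * 88" "\<And>d. d \<in> set small_primes \<Longrightarrow> p = d \<or> p mod d \<noteq> 0"
    unfolding list_all_iff by blast+
  show "prime p"
  proof (rule prime_natI)
    fix d assume d: "prime d" "d < p" "d * d \<le> p"
    have "d < 88"
    proof (rule ccontr)
      assume "\<not> d < 88"
      then have "88 * 88 \<le> d * d" by (intro mult_mono) auto
      with d(3) *(2) show False by linarith
    qed
    then show "\<not> d dvd p"
      using d *(3) [OF small_primes] by (auto simp: dvd_eq_mod_eq_0)
  qed (fact *(1))
qed

lemma successively_interval:
  fixes x m :: nat
  assumes "successively (\<lambda>p q. q \<le> f p) (x # xs)" "mono f" "x \<le> m" "m < last (x # xs)"
  shows "\<exists>q\<in>set xs. m < q \<and> q \<le> f m"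
  using assms
proof (induction xs arbitrary: x)
  case (Cons y ys)
  show ?case
  proof (cases "m < y")
    case True
    have "y \<le> f x" using Cons.prems(1) by simp
    also have "f x \<le> f m" using Cons.prems(2,3) by (rule monoD)
    finally show ?thesis using True by auto
  next
    case False
    then show ?thesis using Cons.IH [of y] Cons.prems by (auto simp: successively_Cons)
  qed
qed simp

text \<open>Shaped for \<open>smooth_odd_run_medium\<close>: there m + 22 < 30 l, which makes (m +
  22) div 15 - 1 at most 2l - 2, and 16 = 2 * 9 - 2 is available from l = 9 on. The range starts at
  17 = 2 * 9 - 1 and covers all m below 30 * 255.\<close>

lemma prime_gap:
  assumes "17 \<le> m" "m < (7727 :: nat)"
  shows "\<exists>q. prime q \<and> m < q \<and> q \<le> m + max 16 ((m + 22) div 15 - 1)"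
proof -
  let ?f = "\<lambda>p :: nat. p + max 16 ((p + 22) div 15 - 1)"
  have "successively (\<lambda>p q. q \<le> ?f p) prime_chain"
    by (simp add: prime_chain_def)
  moreover have "prime_chain = 17 # tl prime_chain" "last prime_chain = 7727"
    by (simp_all add: prime_chain_def)
  moreover have "mono ?f"
    by (intro monoI add_mono max.mono diff_le_mono div_le_mono) auto
  ultimately obtain q where "q \<in> set (tl prime_chain)" "m < q" "q \<le> ?f m"
    using successively_interval [of ?f 17 "tl prime_chain" m] assms by auto
  then show ?thesis
    using prime_chain_prime [of q] list.set_sel(2) [of prime_chain q] by (auto simp: prime_chain_def)
qed

lemma power_128_bound:
  fixes l :: nat
  assumes "9 \<le> l" "l < 256"
  shows "(32 * l) ^ ((l + 4) div 2) * (16 * l) < 128 ^ l"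
proof -
  \<comment> \<open>Rounding \<open>l\<close> up to a power of two turns the claim into a comparison
    of exponents.\<close>
  have *: ?thesis if a: "l \<le> 2 ^ a" "(5 + a) * ((l + 4) div 2) + (4 + a) < 7 * l" for a
  proof -
    have "(32 * l) ^ ((l + 4) div 2) * (16 * l) \<le> (32 * 2 ^ a) ^ ((l + 4) div 2) * (16 * 2 ^ a)"
      using a(1) by (intro mult_mono power_mono) auto
    also have "\<dots> = (2 ^ (5 + a)) ^ ((l + 4) div 2) * (2 ^ (4 + a))"
      by (simp add: power_add)
    also have "\<dots> = (2 :: nat) ^ ((5 + a) * ((l + 4) div 2) + (4 + a))"
      by (simp only: power_add power_mult)
    also have "\<dots> < 2 ^ (7 * l)"
      using a(2) by (intro power_strict_increasing) auto
    also have "\<dots> = 128 ^ l" by (simp add: power_mult)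
    finally show ?thesis .
  qed
  have half: "2 * ((l + 4) div 2) \<le> l + 4" by simp
  consider "l = 9" | "l = 10" | "11 \<le> l" "l \<le> 16" | "17 \<le> l" "l \<le> 32" | "33 \<le> l" "l \<le> 64"
    | "65 \<le> l" "l \<le> 128" | "129 \<le> l" using assms by linarith
  then show ?thesis
  proof cases
    case 3 then show ?thesis using half by (intro * [of 4]) simp_all
  next
    case 4 then show ?thesis using half by (intro * [of 5]) simp_all
  next
    case 5 then show ?thesis using half by (intro * [of 6]) simp_all
  next
    case 6 then show ?thesis using half by (intro * [of 7]) simp_all
  next
    case 7 then show ?thesis using half assms by (intro * [of 8]) simp_all
  qed simp_all
qed

text \<open>If \<open>M < 8 * B\<close>, the run contains the next prime after \<open>m\<close>, and
  this prime exceeds \<open>2 * l - 1\<close>. Otherwise \<open>M\<close> is so large against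
  \<open>B\<close> that about l/2 prime powers of size at most \<open>M\<close> cannot account for
  the product; the base is 128 = 16 * 8.\<close>

lemma smooth_odd_run_medium:
  fixes m l :: nat
  assumes m: "odd m" "m \<ge> 2 * l - 1" and l: "9 \<le> l" "l < 256"
    and smooth: "\<forall>p i. prime p \<and> i < l \<and> p dvd m + 2 * i \<longrightarrow> p \<le> 2 * l - 1"
  shows False
proof -
  define B where "B = 4 * l - 3"
  define M where "M = m + 2 * (l - 1)"
  show False
  proof (cases "M < 8 * B")
    case True
    then have m_less: "m + 22 < 30 * l" using l by (simp add: M_def B_def)
    then obtain p where p: "prime p" "m < p" "p \<le> m + max 16 ((m + 22) div 15 - 1)"
    proof -
      have "17 \<le> m" using l(1) m(2) by linarith
      moreover have "m < 7727" using l(2) m_less by linarith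
      ultimately show ?thesis using prime_gap [of m] that by blast
    qed
    have "(m + 22) div 15 < 2 * l" using m_less by (simp add: less_mult_imp_div_less)
    then have p_le: "p \<le> m + (2 * l - 2)" using p(3) l by auto
    have "odd p" using p(1,2) l m prime_odd_nat [of p] by simp
    define i where "i = (p - m) div 2"
    have "even (p - m)" using \<open>odd p\<close> m(1) by simp
    then have i: "p = m + 2 * i" using p(2) by (simp add: i_def)
    have "i < l" using i p_le l by linarith
    moreover have "p dvd m + 2 * i" unfolding i [symmetric] by simp
    ultimately have "p \<le> 2 * l - 1" using smooth [rule_format, of p i] p(1) by blast
    then show False using p(2) m(2) by linarith
  next
    case False
    obtain q where q:
      "\<forall>p\<in>odd_primes (2 * l - 1). q p \<le> m + 2 * (l - 1)"
      "16 ^ (l - 1) * (m + 2 * (l - 1)) ^ l \<le> (4 * l - 3) ^ l * l * prod q (odd_primes (2 * l - 1))"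
      using smooth_odd_run [OF m _ smooth] l by auto
    define c where "c = (l + 4) div 2"
    have c: "card (odd_primes (2 * l - 1)) \<le> c" "c \<le> l"
      using card_odd_primes_le [of "2 * l - 1"] l by (auto simp: c_def)
    have M: "M > 0" "8 * B \<le> M" using False l by (auto simp: M_def)
    have "16 ^ (l - 1) * (8 * B) ^ (l - c) \<le> B ^ l * l"
    proof (rule cancel_power_le)
      have "16 ^ (l - 1) * M ^ l \<le> B ^ l * l * prod q (odd_primes (2 * l - 1))"
        using q(2) by (simp add: M_def B_def)
      also have "\<dots> \<le> B ^ l * l * M ^ c"
        using q(1) c M by (intro mult_left_mono prod_le_power_card) (auto simp: M_def)
      finally show "16 ^ (l - 1) * M ^ l \<le> B ^ l * l * M ^ c" .
    qed (use M c in auto)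
    then have "16 * (8 * B) ^ c * (16 ^ (l - 1) * (8 * B) ^ (l - c)) \<le> 16 * (8 * B) ^ c * (B ^ l * l)"
      by (rule mult_left_mono) simp
    also have "16 * (8 * B) ^ c * (16 ^ (l - 1) * (8 * B) ^ (l - c)) = 16 ^ Suc (l - 1) * (8 * B) ^ (c + (l - c))"
      by (simp only: power_add power_Suc mult_ac)
    also have "\<dots> = 16 ^ l * (8 * B) ^ l" using l c by simp
    also have "\<dots> = (16 * (8 * B)) ^ l" by (rule power_mult_distrib [symmetric])
    also have "\<dots> = 128 ^ l * B ^ l" by (simp add: power_mult_distrib)
    finally have "B ^ l * 128 ^ l \<le> B ^ l * ((8 * B) ^ c * (16 * l))" by (simp only: mult_ac)
    moreover have "B ^ l > 0" using l by (simp add: B_def)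
    ultimately have "128 ^ l \<le> (8 * B) ^ c * (16 * l)" by (rule mult_left_le_imp_le)
    also have "\<dots> \<le> (32 * l) ^ c * (16 * l)"
      by (intro mult_right_mono power_mono) (auto simp: B_def)
    also have "\<dots> < 128 ^ l" using power_128_bound [OF l] by (simp add: c_def)
    finally show False by simp
  qed
qed

section \<open>Runs of at least 256 terms\<close>

lemma power_4_gt: "l \<ge> 256 \<Longrightarrow> 16 * 3 ^ l * l ^ 5 < (4 :: nat) ^ l"
proof (induction l rule: dec_induct)
  case base
  show ?case by simp
next
  case (step l)
  have "(256 * Suc l) ^ 5 \<le> (257 * l) ^ 5"
    using step.hyps by (intro power_mono) auto
  then have "256 ^ 5 * Suc l ^ 5 \<le> 257 ^ 5 * l ^ 5"
    by (simp only: power_mult_distrib)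
  then have "3 * (256 ^ 5 * Suc l ^ 5) \<le> 3 * (257 ^ 5 * l ^ 5)"
    by (rule mult_le_mono2)
  also have "\<dots> \<le> 4 * 256 ^ 5 * l ^ 5" by simp
  finally have "3 * Suc l ^ 5 \<le> 4 * l ^ 5" by simp
  then have "16 * 3 ^ l * (3 * Suc l ^ 5) \<le> 16 * 3 ^ l * (4 * l ^ 5)"
    by (rule mult_le_mono2)
  also have "\<dots> < 4 * 4 ^ l" using step.IH by simp
  finally show ?case by (simp only: power_Suc mult_ac)
qed

text \<open>The first difference is the exponential rate left when 16^l is weighed against the
  product of the odd primes below 2l. With 4 in place of the fifth root of 432 it would be ln 16 - 2
  ln 4 = 0.\<close>

lemma ln_numeric_bounds:
  "ln 16 - 2 / 5 * ln 432 \<ge> (17 / 50 :: real)" "ln 16 + ln 6 - ln 432 / 5 \<le> (19 / 5 :: real)"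
  "ln 3 \<le> (10 / 9 :: real)"
proof -
  have "exp 1 \<le> (272 / 100 :: real)" using e_less_272 by simp
  then have "ln (exp 1) \<le> ln (272 / 100 :: real)" by (subst ln_le_cancel_iff) auto
  then have "17 \<le> 17 * ln (272 / 100 :: real)" by simp
  also have "\<dots> = ln ((272 / 100) ^ 17)" by (simp only: ln_realpow)
  also have "\<dots> \<le> ln (16 ^ 50 / 432 ^ 20 :: real)" by (subst ln_le_cancel_iff) (simp_all add: field_simps)
  also have "\<dots> = 50 * ln 16 - 20 * ln 432" by (subst ln_div) (simp_all only: ln_realpow, simp_all)
  finally show "ln 16 - 2 / 5 * ln 432 \<ge> (17 / 50 :: real)" by simp
  have "ln (16 * 6) \<le> ln (2 ^ 7 :: real)" by (subst ln_le_cancel_iff) simp_all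
  then have 1: "ln 16 + ln 6 \<le> 7 * ln (2 :: real)" by (simp only: ln_realpow ln_mult) (simp add: ln_mult)
  have "ln (2 ^ 8) \<le> ln (432 :: real)" by (subst ln_le_cancel_iff) simp_all
  then have 2: "8 * ln 2 \<le> ln (432 :: real)" by (simp only: ln_realpow)
  show "ln 16 + ln 6 - ln 432 / 5 \<le> (19 / 5 :: real)" 
    using 1 2 ln2_le_25_over_36 ln2_ge_two_thirds by linarith
  have "ln (3 ^ 5) \<le> ln (2 ^ 8 :: real)" by (subst ln_le_cancel_iff) simp_all
  then have "5 * ln 3 \<le> 8 * ln (2 :: real)" by (simp only: ln_realpow)
  then show "ln 3 \<le> (10 / 9 :: real)" using ln2_le_25_over_36 by linarith
qed

text \<open>
  With \<open>M = m + 2l - 2\<close> and \<open>y = \<surd>M\<close>, taking logarithms for \<open>9M < l\<^sup>2\<close> leads to a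
  lower bound for \<open>(y + 9 - 4l) ln y\<close>.  This function is convex in \<open>y\<close>, so that the
  contradiction need only be checked at both ends \<open>y = \<surd>(4l - 3)\<close> and \<open>y = l / 3\<close>.
\<close>

lemma lower_endpoint:
  fixes l :: real
  assumes l: "l \<ge> 256"
  shows "(sqrt (4 * l) + 9) / 2 * ln (4 * l) <
    2 * ((l - 1) * ln 16 - ln l - ln 6 - (2 * l - 1) / 5 * ln 432)"
proof -
  define z where "z = sqrt (4 * l)"
  have z2: "z * z = 4 * l" unfolding z_def using l by simp
  have "sqrt (32 ^ 2) \<le> z" unfolding z_def using l by (intro real_sqrt_le_mono) simp
  then have z: "z \<ge> 32" by simp
  have "ln z = ln (32 * (z / 32))" by simp
  also have "\<dots> = ln 32 + ln (z / 32)" using z by (subst ln_mult) auto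
  \<comment> \<open>Tangent at 32 = sqrt (4 * 256), the smallest possible \<open>z\<close>.\<close>
  also have "ln (z / 32) \<le> z / 32 - 1" using z by (intro ln_le_minus_one) auto
  also have "ln (32 :: real) = 5 * ln 2" using ln_realpow [of 2 5] by simp
  finally have lnz: "ln z \<le> z / 32 + 89 / 36" using ln2_le_25_over_36 by simp
  have ln4l: "ln (4 * l) = 2 * ln z" unfolding z2 [symmetric] using z by (simp add: ln_mult)
  have "ln (4 * l) = ln 4 + ln l" using l by (subst ln_mult) auto
  moreover have "ln (4 :: real) = 2 * ln 2" using ln_realpow [of 2 2] by simp
  ultimately have lnl: "ln l \<le> 2 * ln z - 4 / 3" using ln4l ln2_ge_two_thirds by linarith
  have "(z + 13) * ln z \<le> (z + 13) * (z / 32 + 89 / 36)"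
    using z lnz by (intro mult_left_mono) auto
  moreover have "(z + 13) * ln z = (z + 9) * ln z + 4 * ln z" by (simp add: algebra_simps)
  moreover have "(z + 13) * (z / 32 + 89 / 36) = z * z / 32 + 829 / 288 * z + 1157 / 36"
    by (simp add: algebra_simps add_divide_distrib)
  ultimately have "(z + 9) * ln z + 4 * ln z \<le> l / 8 + 829 / 288 * z + 1157 / 36"
    unfolding z2 by simp
  moreover have "z * 32 \<le> z * z" using z by (intro mult_left_mono) auto
  moreover have "l * (17 / 50) \<le> l * (ln 16 - 2 / 5 * ln 432)"
    using l ln_numeric_bounds(1) by (intro mult_left_mono) auto
  \<comment> \<open>\<open>x\<close>, \<open>w\<close>, \<open>D\<close>, \<open>E\<close>,
    \<open>L\<close> abbreviate logarithms and products with logarithms, so that only linear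
    arithmetic remains.\<close>
  moreover have "x < 2 * (D - E - L)"
    if "x + 4 * w \<le> l / 8 + 829 / 288 * z + 1157 / 36" "z * 32 \<le> 4 * l" "l * (17 / 50) \<le> D"
      "E \<le> 19 / 5" "L \<le> 2 * w - 4 / 3" for x w D E L
  proof -
    have "x + 2 * L + 2 * E \<le> l / 8 + 829 / 288 * z + 1157 / 36 + 74 / 15"
      using that by argo
    also have "\<dots> < 17 / 25 * l" using that(2) z by argo
    also have "\<dots> \<le> 2 * D" using that(3) by argo
    finally show ?thesis by argo
  qed
  ultimately have "(z + 9) * ln z <
      2 * (l * (ln 16 - 2 / 5 * ln 432) - (ln 16 + ln 6 - ln 432 / 5) - ln l)"
    using ln_numeric_bounds(2) lnl unfolding z2 by blast
  then show ?thesis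
    unfolding ln4l z_def [symmetric] by (simp add: algebra_simps add_divide_distrib diff_divide_distrib)
qed

lemma upper_endpoint:
  fixes l :: real
  assumes l: "l \<ge> 256"
  shows "(l / 3 + (9 - 4 * l)) * ln (l / 3) <
    2 * ((l - 1) * ln 16 - l * ln (4 * l) - ln l - ln 6 - (2 * l - 1) / 5 * ln 432)"
proof -
  have "ln (2 ^ 8) \<le> ln l" using l by (subst ln_le_cancel_iff) simp_all
  then have "8 * ln 2 \<le> ln l" by (simp only: ln_realpow)
  then have lnl: "ln l \<ge> 16 / 3" using ln2_ge_two_thirds by linarith
  have "ln (l / 3) = ln l - ln 3" using l by (subst ln_div) auto
  then have ln3: "ln (l / 3) \<ge> ln l - 10 / 9" using ln_numeric_bounds(3) by simp
  have "(11 * l / 3 - 9) * ln (l / 3) \<ge> (11 * l / 3 - 9) * (ln l - 10 / 9)"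
    using l ln3 by (intro mult_left_mono) auto
  moreover have "(5 / 3 * l - 11) * ln l \<ge> (5 / 3 * l - 11) * (16 / 3)"
    using l lnl by (intro mult_left_mono) auto
  moreover have "l * (ln 16 - 2 / 5 * ln 432) \<ge> l * (17 / 50)"
    using l ln_numeric_bounds(1) by (intro mult_left_mono) auto
  moreover have "l * ln 4 \<le> l * (25 / 18)"
    using l ln2_le_25_over_36 ln_realpow [of 2 2] by (intro mult_left_mono) auto
  ultimately have "(l / 3 + (9 - 4 * l)) * ln (l / 3) < 2 * (D - (F + l * ln l) - E - ln l)"
    if "D = l * (ln 16 - 2 / 5 * ln 432)" "F = l * ln 4" "E = ln 16 + ln 6 - ln 432 / 5" for D E F
    using ln_numeric_bounds(2) l unfolding that [symmetric] by (simp add: algebra_simps)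
  from this [OF refl refl refl] have "(l / 3 + (9 - 4 * l)) * ln (l / 3) <
      2 * (l * (ln 16 - 2 / 5 * ln 432) - l * (ln 4 + ln l) - (ln 16 + ln 6 - ln 432 / 5) - ln l)"
    by (simp only: distrib_left)
  moreover have "ln (4 * l) = ln 4 + ln l" using l by (subst ln_mult) auto
  ultimately show ?thesis by (simp add: algebra_simps diff_divide_distrib)
qed

text \<open>The split compares \<open>M\<close> with (l/3)^2. Above it, counting every odd prime
  with a power as large as \<open>M\<close> is affordable and ends in 3^l against 4^l. Below it,
  only primes up to the square root of \<open>M\<close> are charged \<open>M\<close>, at most (sqrt
  M + 9) / 4 of them; the others count once and are covered by \<open>odd_primorial\<close>.\<close>

lemma smooth_odd_run_large:
  fixes m l :: nat
  assumes m: "odd m" "m \<ge> 2 * l - 1" and l: "l \<ge> 256"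
    and smooth: "\<forall>p i. prime p \<and> i < l \<and> p dvd m + 2 * i \<longrightarrow> p \<le> 2 * l - 1"
  shows False
proof -
  define B where "B = 4 * l - 3"
  define M where "M = m + 2 * (l - 1)"
  define A where "A = odd_primes (2 * l - 1)"
  have MB: "M \<ge> B" using m l by (simp add: M_def B_def)
  have B0: "B \<ge> 1000" using l by (simp add: B_def)
  obtain q where
    "\<forall>p\<in>odd_primes (2 * l - 1). q p \<le> m + 2 * (l - 1)"
    "\<forall>p\<in>odd_primes (2 * l - 1). m + 2 * (l - 1) < p * p \<longrightarrow> q p \<le> p"
    "16 ^ (l - 1) * (m + 2 * (l - 1)) ^ l \<le> (4 * l - 3) ^ l * l * prod q (odd_primes (2 * l - 1))"
    using smooth_odd_run [OF m _ smooth] l by auto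
  then have q: "\<And>p. p \<in> A \<Longrightarrow> q p \<le> M" "\<And>p. p \<in> A \<Longrightarrow> M < p * p \<Longrightarrow> q p \<le> p"
    and le: "16 ^ (l - 1) * M ^ l \<le> B ^ l * l * prod q A"
    by (simp_all add: A_def M_def B_def)
  have finA [simp]: "finite A" by (simp add: A_def)
  show False
  proof (cases "l * l \<le> 9 * M")
    case True
    define c where "c = (l + 4) div 2"
    have c: "card A \<le> c" "c \<le> l" "l - 4 \<le> 2 * (l - c)" "2 * (l - c) \<le> l"
      using card_odd_primes_le [of "2 * l - 1"] l by (auto simp: c_def A_def)
    have "16 ^ (l - 1) * M ^ (l - c) \<le> B ^ l * l"
    proof (rule cancel_power_le)
      have "B ^ l * l * prod q A \<le> B ^ l * l * M ^ c"
        using q(1) c MB B0 by (intro mult_left_mono prod_le_power_card) auto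
      with le show "16 ^ (l - 1) * M ^ l \<le> B ^ l * l * M ^ c" by linarith
    qed (use c MB B0 in auto)
    then have "16 * l ^ 4 * 9 ^ (l - c) * (16 ^ (l - 1) * M ^ (l - c)) \<le> 16 * l ^ 4 * 9 ^ (l - c) * (B ^ l * l)"
      by (rule mult_le_mono2)
    moreover have "16 ^ l * l ^ l \<le> 16 * l ^ 4 * 9 ^ (l - c) * (16 ^ (l - 1) * M ^ (l - c))"
    proof -
      have "l ^ l = l ^ 4 * l ^ (l - 4)" using l by (simp flip: power_add)
      also have "l ^ (l - 4) \<le> l ^ (2 * (l - c))" using c l by (intro power_increasing) auto
      also have "l ^ (2 * (l - c)) = (l * l) ^ (l - c)" by (simp add: power_mult power2_eq_square)
      also have "(l * l) ^ (l - c) \<le> (9 * M) ^ (l - c)" using True by (rule power_mono) simp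
      finally have "l ^ l \<le> l ^ 4 * (9 ^ (l - c) * M ^ (l - c))" by (simp add: power_mult_distrib)
      then have "16 ^ l * l ^ l \<le> 16 ^ l * (l ^ 4 * (9 ^ (l - c) * M ^ (l - c)))"
        by (rule mult_le_mono2)
      moreover have "(16 :: nat) ^ l = 16 * 16 ^ (l - 1)" using l by (simp flip: power_Suc)
      ultimately show ?thesis by (simp only: mult_ac)
    qed
    moreover have "16 * l ^ 4 * 9 ^ (l - c) * (B ^ l * l) \<le> 16 * l ^ 4 * 3 ^ l * ((4 * l) ^ l * l)"
    proof -
      have "(9 :: nat) ^ (l - c) = 3 ^ (2 * (l - c))" by (simp add: power_mult)
      also have "\<dots> \<le> 3 ^ l" using c by (intro power_increasing) auto
      finally show ?thesis by (intro mult_mono power_mono) (auto simp: B_def)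
    qed
    ultimately have "16 ^ l * l ^ l \<le> 16 * l ^ 4 * 3 ^ l * ((4 * l) ^ l * l)" by linarith
    also have "(16 :: nat) ^ l = 4 ^ l * 4 ^ l" by (simp flip: power_mult_distrib)
    also have "16 * l ^ 4 * 3 ^ l * ((4 * l) ^ l * l) = (4 ^ l * l ^ l) * (16 * 3 ^ l * l ^ 5)"
    proof -
      have "l ^ 5 = l ^ 4 * l" by (simp add: eval_nat_numeral)
      then show ?thesis by (simp only: power_mult_distrib mult_ac)
    qed
    finally have "(4 ^ l * l ^ l) * 4 ^ l \<le> (4 ^ l * l ^ l) * (16 * 3 ^ l * l ^ 5)"
      by (simp only: mult_ac)
    then have "4 ^ l \<le> 16 * 3 ^ l * l ^ 5" using l by (auto simp only: mult_le_cancel1) simp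
    with power_4_gt [OF l] show False by simp
  next
    case False
    define y where "y = sqrt (real M)"
    have M0: "M > 0" using MB B0 by simp
    have yy: "y * y = real M" by (simp add: y_def)
    have y_pos: "y > 0" using M0 by (simp add: y_def)
    have y_ge: "sqrt (real B) \<le> y" using MB by (simp add: y_def)
    have y_le: "y \<le> real l / 3"
    proof -
      have "real (9 * M) \<le> real (l * l)" using False by (simp only: of_nat_le_iff)
      then have "real M \<le> (real l / 3) ^ 2" by (simp add: power2_eq_square)
      then show ?thesis unfolding y_def by (intro real_le_lsqrt) auto
    qed
    define S where "S = {p \<in> A. p * p \<le> M}"
    define s where "s = nat \<lfloor>y\<rfloor>"
    have "S \<subseteq> odd_primes s"
    proof
      fix p assume "p \<in> S"
      then have p: "p \<in> A" "p * p \<le> M" by (auto simp: S_def)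
      have "real (p * p) \<le> real M" using p(2) by (simp only: of_nat_le_iff)
      then have "real p \<le> y" unfolding y_def by (intro real_le_rsqrt) (simp add: power2_eq_square)
      then have "p \<le> s" unfolding s_def by (simp add: le_nat_floor)
      then show "p \<in> odd_primes s" using p(1) by (simp add: A_def odd_primes_def)
    qed
    then have "card S \<le> card (odd_primes s)" by (intro card_mono) auto
    then have "4 * card S \<le> s + 9" using card_odd_primes_le [of s] by linarith
    then have "real (4 * card S) \<le> real (s + 9)" by (simp only: of_nat_le_iff)
    moreover have "real s \<le> y" unfolding s_def using y_pos by simp
    ultimately have card_S: "real (card S) \<le> (y + 9) / 4" by simp
    have "prod q A = prod q (A - S) * prod q S"
      by (rule prod.subset_diff) (auto simp: S_def)
    also have "\<dots> \<le> odd_primorial (2 * l - 1) * M ^ card S"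
    proof (rule mult_mono)
      have "prod q (A - S) \<le> \<Prod>(A - S)"
        using q(2) by (intro prod_mono) (auto simp: S_def not_le)
      also have "\<dots> \<le> \<Prod>A"
        using odd_primorial_pos [of "2 * l - 1"]
        by (intro dvd_imp_le prod_dvd_prod_subset) (auto simp: A_def odd_primorial_def)
      finally show "prod q (A - S) \<le> odd_primorial (2 * l - 1)" by (simp add: A_def odd_primorial_def)
      show "prod q S \<le> M ^ card S"
        using q(1) M0 by (intro prod_le_power_card) (auto simp: S_def)
    qed simp_all
    finally have "B ^ l * l * prod q A \<le> B ^ l * l * (odd_primorial (2 * l - 1) * M ^ card S)"
      by (rule mult_le_mono2)
    with le have "16 ^ (l - 1) * M ^ l \<le> B ^ l * l * (odd_primorial (2 * l - 1) * M ^ card S)"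
      by linarith
    then have "real (16 ^ (l - 1) * M ^ l) \<le> real (B ^ l * l * (odd_primorial (2 * l - 1) * M ^ card S))"
      by (simp only: of_nat_le_iff)
    then have "ln (real (16 ^ (l - 1) * M ^ l)) \<le> ln (real (B ^ l * l * (odd_primorial (2 * l - 1) * M ^ card S)))"
      using M0 by (subst ln_le_cancel_iff) (use B0 l odd_primorial_pos [of "2 * l - 1"] in auto)
    moreover have "ln (real (16 ^ (l - 1) * M ^ l)) = real (l - 1) * ln 16 + real l * ln (real M)"
      using M0 by (simp add: ln_mult ln_realpow)
    moreover have "ln (real (B ^ l * l * (odd_primorial (2 * l - 1) * M ^ card S))) =
       real l * ln (real B) + ln (real l) + (ln (real (odd_primorial (2 * l - 1))) + real (card S) * ln (real M))"
      using M0 B0 l odd_primorial_pos [of "2 * l - 1"] by (simp add: ln_mult ln_realpow)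
    moreover have "ln (real M) = 2 * ln y" unfolding yy [symmetric] using y_pos by (simp add: ln_mult)
    moreover have "ln (real (odd_primorial (2 * l - 1))) \<le> ln 6 + real (2 * l - 1) / 5 * ln 432"
      by (rule ln_odd_primorial_le)
    moreover have "real (2 * l - 1) = 2 * real l - 1" "real (l - 1) = real l - 1"
      using l by (simp_all add: of_nat_diff)
    ultimately have main: "(real l - 1) * ln 16 + real l * (2 * ln y) \<le>
        real l * ln (real B) + ln (real l) + ln 6 + (2 * real l - 1) / 5 * ln 432 + real (card S) * (2 * ln y)"
      by simp
    have "1 \<le> sqrt (real B)" using B0 by simp
    then have ln_y: "ln y \<ge> 0" using y_ge by (intro ln_ge_zero) linarith
    have "real (card S) * (2 * ln y) \<le> (y + 9) / 4 * (2 * ln y)"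
      using card_S ln_y by (intro mult_right_mono) auto
    \<comment> \<open>Collects all terms in \<open>ln y\<close> on one side; the summand
      \<open>0 * y\<close> matches \<open>convex_on_add_mult_ln\<close> with
      \<open>d = 0\<close>.\<close>
    moreover have "2 * (C - D - a - b - T) \<le> (y + (9 - 4 * real l)) * ln y - 0 * y"
      if "C + real l * (2 * ln y) \<le> D + a + b + T + cs" "cs \<le> (y + 9) / 4 * (2 * ln y)" for C D a b T cs
      using that by (simp add: algebra_simps)
    ultimately have g: "2 * ((real l - 1) * ln 16 - real l * ln (real B) - ln (real l) - ln 6
        - (2 * real l - 1) / 5 * ln 432) \<le> (y + (9 - 4 * real l)) * ln y - 0 * y"
      using main by blast
    let ?g = "\<lambda>y. (y + (9 - 4 * real l)) * ln y - 0 * y"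
    let ?K = "(real l - 1) * ln 16 - ln (real l) - ln 6 - (2 * real l - 1) / 5 * ln 432"
    have "convex_on {sqrt (real B)..real l / 3} ?g"
      using \<open>1 \<le> sqrt (real B)\<close> l by (intro convex_on_add_mult_ln) linarith+
    then have "?g y \<le> max (?g (sqrt (real B))) (?g (real l / 3))"
      by (rule convex_on_le_max) (use y_ge y_le in simp)
    moreover have "?g (sqrt (real B)) < 2 * (?K - real l * ln (real B))"
    proof -
      have B4: "real B \<le> 4 * real l" "real B > 0" using B0 by (auto simp: B_def)
      have "ln (sqrt (real B)) = ln (real B) / 2" using B4 by (simp add: ln_sqrt)
      then have "?g (sqrt (real B)) = (sqrt (real B) + 9) / 2 * ln (real B) - 2 * real l * ln (real B)"
        by (simp only: diff_divide_distrib) (simp add: algebra_simps)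
      also have "(sqrt (real B) + 9) / 2 * ln (real B) \<le> (sqrt (4 * real l) + 9) / 2 * ln (4 * real l)"
        using B4 B0 by (intro mult_mono divide_right_mono add_right_mono real_sqrt_le_mono) auto
      also have "\<dots> < 2 * ?K" using lower_endpoint [of "real l"] l by simp
      finally show ?thesis by simp
    qed
    moreover have "?g (real l / 3) < 2 * (?K - real l * ln (real B))"
    proof -
      have "real l * ln (real B) \<le> real l * ln (4 * real l)"
        using B0 l by (intro mult_left_mono) (auto simp: B_def)
      moreover have "real l \<ge> 256" using l by simp
      note upper_endpoint [OF this]
      moreover have "g - 0 * q < 2 * (C - a - b - T - x)"
        if "x \<le> x'" "g < 2 * (C - x' - a - b - T)" for g q C a b T x x' :: real
        using that by simp
      ultimately show ?thesis by blast
    qed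
    ultimately show False using g by simp
  qed
qed

theorem consecutive_odd_large_prime_factor:
  fixes m l :: nat
  assumes "odd m" "m \<ge> 2 * l - 1" "m \<ge> 3" "l \<ge> 1"
  shows "\<exists>p i. prime p \<and> i < l \<and> p dvd m + 2 * i \<and> 2 * l < p"
proof (rule ccontr)
  assume contra: "\<nexists>p i. prime p \<and> i < l \<and> p dvd m + 2 * i \<and> 2 * l < p"
  have smooth: "\<forall>p i. prime p \<and> i < l \<and> p dvd m + 2 * i \<longrightarrow> p \<le> 2 * l - 1"
  proof (intro allI impI)
    fix p i assume p: "prime p \<and> i < l \<and> p dvd m + 2 * i"
    then have "p \<le> 2 * l" using contra not_less [of "2 * l" p] by blast
    moreover have "odd p" using p assms(1) dvd_trans [of 2 p "m + 2 * i"] by auto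
    then have "p \<noteq> 2 * l" by auto
    ultimately show "p \<le> 2 * l - 1" by simp
  qed
  consider "l = 1" | "2 \<le> l" "l \<le> 8" | "9 \<le> l" "l < 256" | "256 \<le> l"
    using assms(4) by linarith
  then show False
  proof cases
    case 1
    have "m \<noteq> 1" using assms(3) by simp
    then obtain p where p: "prime p" "p dvd m" using prime_factor_nat by blast
    then have "p \<le> 1" using smooth [rule_format, of p 0] 1 by simp
    then show False using prime_ge_2_nat [OF p(1)] by simp
  next
    case 2
    then show False using smooth_odd_run_small [OF assms(1,2) _ _ smooth] by blast
  next
    case 3
    then show False using smooth_odd_run_medium [OF assms(1,2) _ _ smooth] by blast
  next
    case 4
    then show False using smooth_odd_run_large [OF assms(1,2) _ smooth] by blast
  qed
qed

subsection \<open>Division by a monic polynomial and reduction modulo a prime\<close>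

text \<open>Pseudo-division scales by a power of the leading coefficient, so for monic divisors it
  is true division, available over the integers.\<close>

definition mquot :: "int poly \<Rightarrow> int poly \<Rightarrow> int poly" where
  "mquot \<phi> g = fst (pseudo_divmod g \<phi>)"

definition mrem :: "int poly \<Rightarrow> int poly \<Rightarrow> int poly" where
  "mrem \<phi> g = snd (pseudo_divmod g \<phi>)"

lemma monic_div:
  assumes "monic \<phi>" "degree \<phi> > 0"
  shows "g = \<phi> * mquot \<phi> g + mrem \<phi> g" "degree (mrem \<phi> g) < degree \<phi>"
proof -
  have "\<phi> \<noteq> 0" using assms(2) by auto
  from pseudo_divmod [OF this, of g "mquot \<phi> g" "mrem \<phi> g"]
  show "g = \<phi> * mquot \<phi> g + mrem \<phi> g" "degree (mrem \<phi> g) < degree \<phi>"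
    using assms by (auto simp: mquot_def mrem_def)
qed

lemma monic_div_unique:
  fixes \<phi> :: "int poly"
  assumes "monic \<phi>" "\<phi> * q + r = \<phi> * q' + r'" "degree r < degree \<phi>" "degree r' < degree \<phi>"
  shows "q = q'" "r = r'"
proof -
  have eq: "\<phi> * (q - q') = r' - r" using assms(2) by (simp add: algebra_simps)
  show "q = q'"
  proof (rule ccontr)
    assume "q \<noteq> q'"
    then have "q - q' \<noteq> 0" by simp
    moreover have "\<phi> \<noteq> 0" using assms(3) by auto
    ultimately have "degree \<phi> \<le> degree (\<phi> * (q - q'))" by (simp add: degree_mult_eq)
    also have "\<dots> < degree \<phi>" unfolding eq using assms(3,4) by (rule degree_diff_less [rotated])
    finally show False by simp
  qed
  with assms(2) show "r = r'" by simp
qed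

lemma mquot_mrem_eqI:
  assumes "monic \<phi>" "degree \<phi> > 0" "g = \<phi> * q + r" "degree r < degree \<phi>"
  shows "mquot \<phi> g = q" "mrem \<phi> g = r"
  using monic_div_unique [OF assms(1), of "mquot \<phi> g" "mrem \<phi> g" q r] monic_div [OF assms(1,2), of g] assms
  by auto

lemma degree_mquot_less:
  assumes "monic \<phi>" "degree \<phi> > 0" "degree g < 2 * degree \<phi>"
  shows "degree (mquot \<phi> g) < degree \<phi>"
proof (cases "mquot \<phi> g = 0")
  case False
  have "\<phi> \<noteq> 0" using assms(2) by auto
  then have "degree \<phi> + degree (mquot \<phi> g) = degree (\<phi> * mquot \<phi> g)"
    using False by (simp add: degree_mult_eq)
  also have "\<phi> * mquot \<phi> g = g - mrem \<phi> g" using monic_div(1) [OF assms(1,2), of g] by simp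
  also have "degree (g - mrem \<phi> g) < 2 * degree \<phi>"
    using assms(3) monic_div(2) [OF assms(1,2), of g] by (intro degree_diff_less) auto
  finally show ?thesis by simp
qed (use assms in simp)

lemma mrem_add:
  assumes "monic \<phi>" "degree \<phi> > 0"
  shows "mrem \<phi> (g + h) = mrem \<phi> g + mrem \<phi> h"
proof (rule mquot_mrem_eqI [OF assms])
  show "g + h = \<phi> * (mquot \<phi> g + mquot \<phi> h) + (mrem \<phi> g + mrem \<phi> h)"
    using monic_div(1) [OF assms, of g] monic_div(1) [OF assms, of h] by (simp add: algebra_simps)
  show "degree (mrem \<phi> g + mrem \<phi> h) < degree \<phi>"
    using monic_div(2) [OF assms] by (intro degree_add_less)
qed

lemma degree_const_mult_less: "degree g < n \<Longrightarrow> degree ([:c:] * g) < n" for g :: "int poly"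
  using degree_smult_le [of c g] by simp

lemma mquot_mrem_const_mult:
  assumes "monic \<phi>" "degree \<phi> > 0"
  shows "mquot \<phi> ([:c:] * g) = [:c:] * mquot \<phi> g" "mrem \<phi> ([:c:] * g) = [:c:] * mrem \<phi> g"
proof -
  have *: "[:c:] * g = \<phi> * ([:c:] * mquot \<phi> g) + [:c:] * mrem \<phi> g"
    using arg_cong [OF monic_div(1) [OF assms, of g], of "\<lambda>x. [:c:] * x"]
    by (simp only: distrib_left mult.left_commute)
  have "degree ([:c:] * mrem \<phi> g) < degree \<phi>"
    using monic_div(2) [OF assms] by (rule degree_const_mult_less)
  from mquot_mrem_eqI [OF assms * this]
  show "mquot \<phi> ([:c:] * g) = [:c:] * mquot \<phi> g" "mrem \<phi> ([:c:] * g) = [:c:] * mrem \<phi> g" .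
qed

text \<open>\<open>g\<close> is its own remainder modulo \<open>\<psi>\<close>, and taking
  remainders commutes with multiplication by constants.\<close>

lemma const_dvd_reduce:
  fixes g :: "int poly"
  assumes "monic \<psi>" "degree g < degree \<psi>" "[:c:] dvd g - \<psi> * h"
  shows "[:c:] dvd g"
proof -
  have pos: "degree \<psi> > 0" using assms(2) by simp
  obtain b where b: "g - \<psi> * h = [:c:] * b" using assms(3) by blast
  have "g = \<psi> * h + [:c:] * b" using b by (simp add: algebra_simps)
  also have "\<dots> = \<psi> * (h + [:c:] * mquot \<psi> b) + [:c:] * mrem \<psi> b"
    by (subst monic_div(1) [OF assms(1) pos, of b]) (simp only: distrib_left mult.left_commute add.assoc)
  finally have g: "g = \<psi> * (h + [:c:] * mquot \<psi> b) + [:c:] * mrem \<psi> b" .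
  have "mrem \<psi> g = [:c:] * mrem \<psi> b"
    using mquot_mrem_eqI(2) [OF assms(1) pos g] degree_const_mult_less [OF monic_div(2) [OF assms(1) pos]]
    by blast
  moreover have "mrem \<psi> g = g"
    by (rule mquot_mrem_eqI(2) [OF assms(1) pos, of _ 0]) (use assms(2) in simp_all)
  ultimately show ?thesis by (metis dvd_triv_left)
qed

lemma Mp_eq_iff: "poly_mod.Mp p f = poly_mod.Mp p g \<longleftrightarrow> [:p:] dvd f - g"
  by (simp add: poly_eq_iff poly_mod.Mp_coeff poly_mod.M_def const_poly_dvd_iff mod_eq_dvd_iff)

lemma prime_elem_const_int: "prime p \<Longrightarrow> prime_elem [:p:]" for p :: int
  by (intro lift_prime_elem_poly prime_imp_prime_elem)

lemma not_const_dvd_monic: "prime p \<Longrightarrow> monic f \<Longrightarrow> \<not> [:p:] dvd f" for p :: int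
  by (metis const_poly_dvd_iff not_prime_unit)

text \<open>
  Divisibility by \<open>[:p:]\<close> stands for vanishing modulo \<open>p\<close>, so that no quotient ring is needed.
\<close>

lemma monic_smaller_representative:
  fixes r :: "int poly"
  assumes p: "prime p" and r: "\<not> [:p:] dvd r"
  obtains m c where "monic m" "degree m \<le> degree r" "[:p:] dvd m - smult c r"
proof -
  define r' where "r' = poly_mod.Mp p r"
  have rr': "[:p:] dvd r' - r" unfolding Mp_eq_iff [symmetric] r'_def by (simp add: poly_mod.Mp_Mp)
  have "r' \<noteq> 0"
  proof
    assume "r' = 0"
    with rr' r show False by (simp add: dvd_minus_iff)
  qed
  define a where "a = lead_coeff r'"
  have "a \<noteq> 0" using \<open>r' \<noteq> 0\<close> by (simp add: a_def)
  moreover have "a mod p = a" unfolding a_def r'_def poly_mod.Mp_coeff poly_mod.M_def by simp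
  ultimately have "\<not> p dvd a" by auto
  then have "gcd a p = 1"
    using p by (metis gcd.commute gcd_dvd1 gcd_dvd2 prime_int_iff abs_of_nonneg gcd_ge_0_int)
  then obtain c t where ct: "c * a + t * p = 1" using bezout_int by metis
  define m where "m = smult c r' + monom (t * p) (degree r')"
  have "coeff m (degree r') = 1" using ct by (simp add: m_def a_def)
  moreover have "degree m \<le> degree r'"
    unfolding m_def by (intro degree_add_le degree_smult_le degree_monom_le)
  ultimately have m: "degree m = degree r'" "monic m"
    using le_degree [of m "degree r'"] by auto
  have "degree r' \<le> degree r" unfolding r'_def by (rule poly_mod.degree_m_le)
  moreover have "[:p:] dvd m - smult c r"
  proof -
    have "m - smult c r = [:c:] * (r' - r) + [:p:] * monom t (degree r')"
      by (simp add: m_def smult_diff_right smult_monom mult.commute)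
    then show ?thesis using rr' by (metis dvd_add dvd_mult dvd_triv_left)
  qed
  ultimately show thesis using m that by metis
qed

text \<open>The principal ideal argument modulo \<open>p\<close>: \<open>I\<close> consists of all
  \<open>x\<close> for which \<open>\<phi>\<close> divides \<open>x * g\<close>, and a monic member
  \<open>d\<close> of least degree generates it. As \<open>d\<close> divides \<open>\<phi>\<close>,
  either \<open>d\<close> is a unit and 1 lies in \<open>I\<close>, or the cofactor is a unit and
  \<open>\<phi>\<close> divides \<open>f\<close>.\<close>

lemma irreducible_m_prime:
  fixes \<phi> f g :: "int poly"
  assumes p: "prime p" and \<phi>: "monic \<phi>" and irr: "poly_mod.irreducible_m p \<phi>"
    and fg: "[:p:] dvd f * g - \<phi> * k"
  shows "(\<exists>h. [:p:] dvd f - \<phi> * h) \<or> (\<exists>h. [:p:] dvd g - \<phi> * h)"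
proof -
  define I where "I = {x. \<exists>h. [:p:] dvd x * g - \<phi> * h}"
  have f: "f \<in> I" using fg by (auto simp: I_def)
  have \<phi>I: "\<phi> \<in> I" unfolding I_def by (auto intro!: exI [of _ g])
  have I_mult: "x * y \<in> I" if "x \<in> I" for x y
  proof -
    obtain h where "[:p:] dvd x * g - \<phi> * h" using \<open>x \<in> I\<close> by (auto simp: I_def)
    then have "[:p:] dvd y * (x * g - \<phi> * h)" by (rule dvd_mult)
    also have "y * (x * g - \<phi> * h) = x * y * g - \<phi> * (y * h)" by (simp add: algebra_simps)
    finally show ?thesis by (auto simp: I_def)
  qed
  have I_cong: "y \<in> I" if "x \<in> I" "[:p:] dvd y - x" for x y
  proof -
    obtain h where h: "[:p:] dvd x * g - \<phi> * h" using \<open>x \<in> I\<close> by (auto simp: I_def)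
    have "[:p:] dvd (y - x) * g" using that(2) by (rule dvd_mult2)
    from dvd_add [OF this h] have "[:p:] dvd y * g - \<phi> * h" by (simp add: algebra_simps)
    then show ?thesis by (auto simp: I_def)
  qed
  have I_diff: "x - y \<in> I" if "x \<in> I" "y \<in> I" for x y
  proof -
    obtain h h' where "[:p:] dvd x * g - \<phi> * h" "[:p:] dvd y * g - \<phi> * h'"
      using \<open>x \<in> I\<close> \<open>y \<in> I\<close> by (auto simp: I_def)
    from dvd_diff [OF this] have "[:p:] dvd (x - y) * g - \<phi> * (h - h')" by (simp add: algebra_simps)
    then show ?thesis by (auto simp: I_def)
  qed
  obtain d where d: "d \<in> I" "monic d" and min: "\<And>x. x \<in> I \<Longrightarrow> monic x \<Longrightarrow> degree d \<le> degree x"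
    using ex_has_least_nat [of "\<lambda>x. x \<in> I \<and> monic x" \<phi> degree] \<phi>I \<phi> by auto
  have gen: "\<exists>q. [:p:] dvd x - d * q" if x: "x \<in> I" for x
  proof (cases "degree d = 0")
    case True
    then have "d = 1" using d(2) by (metis degree_0_id lead_coeff_pCons(2) one_pCons pCons_0_0 coeff_pCons_0)
    then show ?thesis by (auto intro!: exI [of _ x])
  next
    case False
    then have pos: "degree d > 0" by simp
    have rem: "mrem d x = x - d * mquot d x" using monic_div(1) [OF d(2) pos, of x] by simp
    have rI: "mrem d x \<in> I" unfolding rem using I_diff [OF x I_mult [OF d(1)]] .
    have "[:p:] dvd mrem d x"
    proof (rule ccontr)
      assume "\<not> [:p:] dvd mrem d x"
      then obtain m c where m: "monic m" "degree m \<le> degree (mrem d x)" "[:p:] dvd m - smult c (mrem d x)"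
        by (rule monic_smaller_representative [OF p])
      have "mrem d x * [:c:] \<in> I" using rI by (rule I_mult)
      moreover have "[:p:] dvd m - mrem d x * [:c:]" using m(3) by simp
      ultimately have "m \<in> I" by (rule I_cong)
      then have "degree d \<le> degree m" using m(1) by (rule min)
      also have "\<dots> < degree d" using m(2) monic_div(2) [OF d(2) pos, of x] by simp
      finally show False by simp
    qed
    then show ?thesis unfolding rem by blast
  qed
  obtain q where q: "[:p:] dvd \<phi> - d * q" using gen [OF \<phi>I] by blast
  then have "poly_mod.dvdm p d 1 \<or> poly_mod.dvdm p q 1"
    using irr unfolding poly_mod.irreducible_m_def Mp_eq_iff by blast
  then show ?thesis
  proof
    assume "poly_mod.dvdm p d 1"
    then obtain h where "[:p:] dvd 1 - d * h" unfolding poly_mod.dvdm_def Mp_eq_iff by blast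
    then have "1 \<in> I" by (rule I_cong [OF I_mult [OF d(1)]])
    then show ?thesis by (auto simp: I_def)
  next
    assume "poly_mod.dvdm p q 1"
    then obtain h where h: "[:p:] dvd 1 - q * h" unfolding poly_mod.dvdm_def Mp_eq_iff by blast
    obtain q' where q': "[:p:] dvd f - d * q'" using gen [OF f] by blast
    have "f - \<phi> * (h * q') = (f - d * q') + (1 - q * h) * (d * q') - (\<phi> - d * q) * (h * q')"
      by (simp add: algebra_simps)
    moreover have "[:p:] dvd (f - d * q') + (1 - q * h) * (d * q') - (\<phi> - d * q) * (h * q')"
      by (rule dvd_diff [OF dvd_add [OF q' dvd_mult2 [OF h]] dvd_mult2 [OF q]])
    ultimately show ?thesis by metis
  qed
qed

text \<open>Factors \<open>\<phi>\<close> move into \<open>H\<close> one at a time; after each,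
  \<open>\<phi>\<close> itself is cancelled because \<open>[:p:]\<close> is prime and divides no
  monic polynomial.\<close>

lemma power_dvd_cancel_mod:
  fixes \<phi> G H :: "int poly"
  assumes p: "prime p" and \<phi>: "monic \<phi>" and irr: "poly_mod.irreducible_m p \<phi>"
    and G: "\<nexists>h. [:p:] dvd G - \<phi> * h"
  shows "[:p:] dvd G * H - \<phi> ^ N * A \<Longrightarrow> \<exists>B. [:p:] dvd H - \<phi> ^ N * B"
proof (induction N arbitrary: H A)
  case 0
  show ?case by (auto intro!: exI [of _ H])
next
  case (Suc N)
  have "[:p:] dvd G * H - \<phi> * (\<phi> ^ N * A)" using Suc.prems by (simp add: mult.assoc)
  then obtain h where h: "[:p:] dvd H - \<phi> * h" using irreducible_m_prime [OF p \<phi> irr] G by blast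
  have "\<phi> * (G * h - \<phi> ^ N * A) = (G * H - \<phi> ^ Suc N * A) - G * (H - \<phi> * h)"
    by (simp add: algebra_simps)
  then have "[:p:] dvd \<phi> * (G * h - \<phi> ^ N * A)"
    using Suc.prems h by (metis dvd_diff dvd_mult)
  then have "[:p:] dvd G * h - \<phi> ^ N * A"
    using prime_elem_dvd_multD [OF prime_elem_const_int [OF p]] not_const_dvd_monic [OF p \<phi>] by blast
  then obtain B where B: "[:p:] dvd h - \<phi> ^ N * B" using Suc.IH by blast
  have "H - \<phi> ^ Suc N * B = (H - \<phi> * h) + \<phi> * (h - \<phi> ^ N * B)"
    by (simp add: algebra_simps)
  then have "[:p:] dvd H - \<phi> ^ Suc N * B" using h B by (metis dvd_add dvd_mult)
  then show ?case by blast
qed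

lemma degree_ge_power_mod:
  fixes \<phi> H :: "int poly"
  assumes "monic \<phi>" "[:p:] dvd H - \<phi> ^ N * B" "\<not> [:p:] dvd H"
  shows "N * degree \<phi> \<le> degree H"
proof (rule ccontr)
  assume "\<not> N * degree \<phi> \<le> degree H"
  moreover have "\<phi> \<noteq> 0" using assms(1) by auto
  then have "degree (\<phi> ^ N) = N * degree \<phi>" using degree_power_eq [of \<phi> N] by (simp add: mult.commute)
  moreover have "monic (\<phi> ^ N)" using assms(1) by (rule monic_power)
  ultimately have "degree H < degree (\<phi> ^ N)" "monic (\<phi> ^ N)" by simp_all
  then have "[:p:] dvd H" using const_dvd_reduce [OF _ _ assms(2)] by blast
  with assms(3) show False by simp
qed

subsection \<open>Expansions in powers of a monic polynomial\<close>

lemma degree_poly_digits: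
  fixes \<phi> :: "int poly" and X :: "int poly poly"
  assumes \<phi>: "monic \<phi>" "degree \<phi> > 0" and X: "\<And>i. degree (coeff X i) < degree \<phi>" and "X \<noteq> 0"
  shows "poly X \<phi> \<noteq> 0"
  using X \<open>X \<noteq> 0\<close>
proof (induction X)
  case 0
  then show ?case by simp
next
  case (pCons a X)
  show ?case
  proof
    assume "poly (pCons a X) \<phi> = 0"
    then have eq: "\<phi> * poly X \<phi> + a = \<phi> * 0 + 0" by simp
    have "degree a < degree \<phi>" using pCons.prems(1) [of 0] by simp
    from monic_div_unique [OF \<phi>(1) eq this] \<phi>(2) have "poly X \<phi> = 0" "a = 0" by simp_all
    moreover have "degree (coeff X i) < degree \<phi>" for i using pCons.prems(1) [of "Suc i"] by simp
    ultimately show False using pCons by auto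
  qed
qed

lemma digits_unique:
  fixes \<phi> :: "int poly" and X Y :: "int poly poly"
  assumes "monic \<phi>" "degree \<phi> > 0" "\<And>i. degree (coeff X i) < degree \<phi>"
    "\<And>i. degree (coeff Y i) < degree \<phi>" "poly X \<phi> = poly Y \<phi>"
  shows "X = Y"
proof (rule ccontr)
  assume "X \<noteq> Y"
  have "degree (coeff (X - Y) i) < degree \<phi>" for i
    unfolding coeff_diff using assms(3,4) by (intro degree_diff_less)
  then have "poly (X - Y) \<phi> \<noteq> 0"
    using assms(1,2) \<open>X \<noteq> Y\<close> by (intro degree_poly_digits) auto
  with assms(5) show False by simp
qed

text \<open>The clause on leading coefficients lets the top digit inherit non-divisibility by a
  prime.\<close>

lemma digits_exist:
  fixes \<phi> g :: "int poly"
  assumes \<phi>: "monic \<phi>" "degree \<phi> > 0"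
  shows "\<exists>X. poly X \<phi> = g \<and> (\<forall>i. degree (coeff X i) < degree \<phi>) \<and>
    degree X = degree g div degree \<phi> \<and> lead_coeff (lead_coeff X) = lead_coeff g"
proof (induction "degree g" arbitrary: g rule: less_induct)
  case less
  show ?case
  proof (cases "degree g < degree \<phi>")
    case True
    then have "degree (coeff [:g:] i) < degree \<phi>" for i by (cases i) auto
    then show ?thesis using True by (intro exI [of _ "[:g:]"]) auto
  next
    case False
    define q where "q = mquot \<phi> g"
    define r where "r = mrem \<phi> g"
    have g: "g = \<phi> * q + r" and r: "degree r < degree \<phi>"
      using monic_div [OF \<phi>, of g] by (simp_all add: q_def r_def)
    have "q \<noteq> 0" using g r False by auto
    moreover have "\<phi> \<noteq> 0" using \<phi>(2) by auto
    ultimately have deg: "degree (\<phi> * q) = degree \<phi> + degree q" by (rule degree_mult_eq [rotated])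
    then have "degree r < degree (\<phi> * q)" using r by simp
    then have "degree (\<phi> * q + r) = degree (\<phi> * q)" "lead_coeff (\<phi> * q + r) = lead_coeff (\<phi> * q)"
      by (simp_all add: degree_add_eq_left coeff_eq_0)
    then have 1: "degree g = degree (\<phi> * q)" and 2: "lead_coeff g = lead_coeff (\<phi> * q)"
      unfolding g by blast+
    have "lead_coeff (\<phi> * q) = lead_coeff q"
      using lead_coeff_mult [of \<phi> q] unfolding \<phi>(1) mult_1 .
    with 2 have lg: "lead_coeff g = lead_coeff q" by (rule trans)
    from 1 deg have dg: "degree g = degree \<phi> + degree q" by (rule trans)
    have "degree q < degree g" using dg \<phi>(2) by simp
    from less [OF this] obtain X where X: "poly X \<phi> = q" "\<forall>i. degree (coeff X i) < degree \<phi>"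
      "degree X = degree q div degree \<phi>" "lead_coeff (lead_coeff X) = lead_coeff q" by blast
    have "X \<noteq> 0" using X(1) \<open>q \<noteq> 0\<close> by auto
    have "degree (coeff (pCons r X) i) < degree \<phi>" for i
      using X(2) r by (cases i) auto
    moreover have "degree (pCons r X) = degree g div degree \<phi>"
      using \<open>X \<noteq> 0\<close> X(3) \<phi>(2) by (simp add: dg)
    moreover have "poly (pCons r X) \<phi> = g" using X(1) g by simp
    moreover have "lead_coeff (lead_coeff (pCons r X)) = lead_coeff g"
      using \<open>X \<noteq> 0\<close> X(4) lg by simp
    ultimately show ?thesis by blast
  qed
qed

subsection \<open>Newton polygons with respect to powers of a polynomial\<close>

lemma const_power_dvd_mult:
  fixes D E :: "int poly"
  assumes p: "prime p" "D \<noteq> 0" "E \<noteq> 0" and n: "n \<le> multiplicity [:p:] D + multiplicity [:p:] E"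
  shows "[:p:] ^ n dvd D * E"
proof -
  have "[:p:] ^ (multiplicity [:p:] D + multiplicity [:p:] E) dvd D * E"
    unfolding power_add by (intro mult_dvd_mono multiplicity_dvd)
  with n show ?thesis by (meson dvd_trans le_imp_power_dvd)
qed

text \<open>
  For \<open>v i\<close> the \<open>p\<close>-adic valuation of the \<open>i\<close>-th digit, \<open>k * v i + i\<close> is minimal on the edge
  of slope \<open>-1/k\<close>; the right end of this edge is additive under multiplication of polynomials.
\<close>

lemma lowest_point:
  fixes v :: "nat \<Rightarrow> nat"
  assumes "finite S" "S \<noteq> {}"
  obtains r where "r \<in> S" "\<And>i. i \<in> S \<Longrightarrow> k * v r + r \<le> k * v i + i"
    "\<And>i. i \<in> S \<Longrightarrow> i > r \<Longrightarrow> k * v r + r < k * v i + i"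
proof -
  define w where "w i = k * v i + i" for i
  define \<alpha> where "\<alpha> = Min (w ` S)"
  define R where "R = {i \<in> S. w i = \<alpha>}"
  have le: "\<alpha> \<le> w i" if "i \<in> S" for i using that assms(1) by (simp add: \<alpha>_def)
  have "\<alpha> \<in> w ` S" unfolding \<alpha>_def using assms by (intro Min_in) auto
  then have R: "finite R" "R \<noteq> {}" using assms by (auto simp: R_def)
  have max: "Max R \<in> R" using R by (rule Max_in)
  show thesis
  proof (rule that [of "Max R"])
    show "Max R \<in> S" using max by (simp add: R_def)
    have *: "k * v (Max R) + Max R = \<alpha>" using max by (simp add: R_def w_def)
    show "k * v (Max R) + Max R \<le> k * v i + i" if "i \<in> S" for i
      unfolding * using le [OF that] by (simp add: w_def)
    show "k * v (Max R) + Max R < k * v i + i" if "i \<in> S" "i > Max R" for i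
    proof -
      have "i \<notin> R" using Max_ge [OF R(1), of i] that(2) by auto
      then have "w i \<noteq> \<alpha>" using that(1) by (simp add: R_def)
      then show ?thesis unfolding * using le [OF that(1)] by (simp add: w_def)
    qed
  qed
qed

text \<open>The quotient of Z[x] by \<open>p\<close> and \<open>\<phi>\<close> has no zero divisors,
  and digits not divisible by \<open>p\<close> are nonzero in it.\<close>

lemma const_mult_mod:
  fixes \<phi> g h :: "int poly"
  assumes p: "prime p" and \<phi>: "monic \<phi>" "degree \<phi> > 0" and irr: "poly_mod.irreducible_m p \<phi>"
    and g: "\<not> [:p:] dvd g" "degree g < degree \<phi>" and h: "\<not> [:p:] dvd h" "degree h < degree \<phi>"
  shows "\<not> [:p:] dvd mrem \<phi> (g * h)"
proof
  assume "[:p:] dvd mrem \<phi> (g * h)"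
  then have "[:p:] dvd g * h - \<phi> * mquot \<phi> (g * h)"
    using monic_div(1) [OF \<phi>, of "g * h"] by (metis add_diff_cancel_left')
  from irreducible_m_prime [OF p \<phi>(1) irr this] show False
    using const_dvd_reduce [OF \<phi>(1) g(2)] const_dvd_reduce [OF \<phi>(1) h(2)] g(1) h(1) by blast
qed

text \<open>
  The hypothesis on the digits of \<open>F\<close> says that its edge of slope \<open>-1/k\<close> degenerates to the
  point with abscissa 0, whereas the right end for \<open>D\<close> has a positive abscissa.
\<close>

lemma newton_polygon_factor:
  fixes \<phi> :: "int poly" and D E F :: "int poly poly"
  assumes p: "prime p" and \<phi>: "monic \<phi>" "degree \<phi> > 0" and irr: "poly_mod.irreducible_m p \<phi>"
    and D: "\<And>i. degree (coeff D i) < degree \<phi>" and E: "\<And>i. degree (coeff E i) < degree \<phi>"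
    and F: "\<And>i. degree (coeff F i) < degree \<phi>"
    and mult: "poly F \<phi> = poly D \<phi> * poly E \<phi>"
    and F0: "\<not> [:p:] ^ Suc v dvd coeff F 0"
    and slope: "\<And>t e. t \<ge> 1 \<Longrightarrow> k * e + t \<le> k * v \<Longrightarrow> [:p:] ^ Suc e dvd coeff F t"
    and k: "k \<ge> 1" and D0: "[:p:] dvd coeff D 0" and Dk: "\<not> [:p:] dvd coeff D k"
  shows False
proof -
  let ?P = "[:p:]" and ?V = "multiplicity [:p:]"
  have pe: "prime_elem ?P" using p by (rule prime_elem_const_int)
  have Pu: "\<not> is_unit ?P" and P0: "?P \<noteq> 0" using pe by auto
  have "F \<noteq> 0" using F0 by auto
  then have "poly D \<phi> * poly E \<phi> \<noteq> 0"
    using degree_poly_digits [OF \<phi> F] mult by simp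
  then have "D \<noteq> 0" "E \<noteq> 0" by auto
  define SD where "SD = {i. coeff D i \<noteq> 0}"
  define SE where "SE = {i. coeff E i \<noteq> 0}"
  have "finite SD" unfolding SD_def using MOST_coeff_eq_0 [of D] by (simp add: eventually_cofinite)
  moreover have "SD \<noteq> {}" using leading_coeff_neq_0 [OF \<open>D \<noteq> 0\<close>] unfolding SD_def by blast
  ultimately obtain r where r: "r \<in> SD"
    "\<And>i. i \<in> SD \<Longrightarrow> k * ?V (coeff D r) + r \<le> k * ?V (coeff D i) + i"
    "\<And>i. i \<in> SD \<Longrightarrow> i > r \<Longrightarrow> k * ?V (coeff D r) + r < k * ?V (coeff D i) + i"
    by (rule lowest_point [of SD k "\<lambda>i. ?V (coeff D i)"]) blast
  have "finite SE" unfolding SE_def using MOST_coeff_eq_0 [of E] by (simp add: eventually_cofinite)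
  moreover have "SE \<noteq> {}" using leading_coeff_neq_0 [OF \<open>E \<noteq> 0\<close>] unfolding SE_def by blast
  ultimately obtain s where s: "s \<in> SE"
    "\<And>i. i \<in> SE \<Longrightarrow> k * ?V (coeff E s) + s \<le> k * ?V (coeff E i) + i"
    "\<And>i. i \<in> SE \<Longrightarrow> i > s \<Longrightarrow> k * ?V (coeff E s) + s < k * ?V (coeff E i) + i"
    by (rule lowest_point [of SE k "\<lambda>i. ?V (coeff E i)"]) blast
  have "k \<in> SD" using Dk by (auto simp: SD_def)
  \<comment> \<open>Index 0 has weight at least \<open>k\<close>, while index \<open>k\<close> has
    weight exactly \<open>k\<close>; \<open>r\<close> is the largest minimizer.\<close>
  have "r \<ge> 1"
  proof (rule ccontr)
    assume "\<not> r \<ge> 1"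
    then have "r = 0" by simp
    then have "?V (coeff D r) \<ge> 1"
      using D0 r(1) Pu by (intro multiplicity_geI) (auto simp: SD_def)
    then have "k \<le> k * ?V (coeff D r)" by simp
    moreover have "?V (coeff D k) = 0" using Dk by (rule not_dvd_imp_multiplicity_0)
    ultimately show False using r(3) [OF \<open>k \<in> SD\<close>] k \<open>r = 0\<close> by simp
  qed
  define e where "e = ?V (coeff D r) + ?V (coeff E s)"
  define T where "T = r + s"
  have T: "T \<ge> 1" using \<open>r \<ge> 1\<close> by (simp add: T_def)
  have point: "k * e + T \<le> k * (?V (coeff D i) + ?V (coeff E j)) + (i + j)"
    if "i \<in> SD" "j \<in> SE" for i j
    using r(2) [OF that(1)] s(2) [OF that(2)] by (simp add: e_def T_def algebra_simps)
  \<comment> \<open>On the antidiagonal of sum \<open>T\<close>, any pair other than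
    \<open>(r, s)\<close> has \<open>i > r\<close> or \<open>j > s\<close>, where minimality is
    strict.\<close>
  have off_corner: "?P ^ Suc e dvd coeff D i * coeff E j" if ij: "i + j = T" "i \<noteq> r" for i j
  proof (cases "i \<in> SD \<and> j \<in> SE")
    case False
    then show ?thesis by (auto simp: SD_def SE_def)
  next
    case True
    have "k * e + T < k * (?V (coeff D i) + ?V (coeff E j)) + (i + j)"
    proof (cases "i > r")
      case True
      with r(3) [of i] s(2) [of j] \<open>i \<in> SD \<and> j \<in> SE\<close> show ?thesis
        by (simp add: e_def T_def algebra_simps)
    next
      case False
      then have "j > s" using ij by (simp add: T_def)
      with r(2) [of i] s(3) [of j] \<open>i \<in> SD \<and> j \<in> SE\<close> show ?thesis
        by (simp add: e_def T_def algebra_simps)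
    qed
    then have "k * e < k * (?V (coeff D i) + ?V (coeff E j))" using ij by simp
    then have "Suc e \<le> ?V (coeff D i) + ?V (coeff E j)" by simp
    with True show ?thesis using p by (intro const_power_dvd_mult) (auto simp: SD_def SE_def)
  qed
  \<comment> \<open>Products on the preceding antidiagonal carry into digit \<open>T\<close>; their
    index sum is smaller by one, so their valuation must exceed \<open>e\<close>.\<close>
  have below: "?P ^ Suc e dvd coeff D i * coeff E j" if ij: "Suc (i + j) = T" for i j
  proof (cases "i \<in> SD \<and> j \<in> SE")
    case False
    then show ?thesis by (auto simp: SD_def SE_def)
  next
    case True
    then have "k * e < k * (?V (coeff D i) + ?V (coeff E j))" using point [of i j] ij by linarith
    then have "Suc e \<le> ?V (coeff D i) + ?V (coeff E j)" by simp
    with True show ?thesis using p by (intro const_power_dvd_mult) (auto simp: SD_def SE_def)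
  qed
  have Pe: "?P ^ n = [:p ^ n:]" for n by (simp add: poly_const_pow)
  \<comment> \<open>The coefficients of \<open>C\<close> are unreduced digit products. Their
    quotients by \<open>\<phi>\<close> already have degree below that of \<open>\<phi>\<close>, so a
    single round of carries gives the digits of \<open>F\<close>.\<close>
  define C where "C = D * E"
  define A where "A = map_poly (mrem \<phi>) C"
  define B where "B = map_poly (mquot \<phi>) C"
  have zero: "mrem \<phi> 0 = 0" "mquot \<phi> 0 = 0"
    using mquot_mrem_eqI [OF \<phi>, of 0 0 0] \<phi>(2) by auto
  have cA: "coeff A i = mrem \<phi> (coeff C i)" and cB: "coeff B i = mquot \<phi> (coeff C i)" for i
    using zero by (simp_all add: A_def B_def coeff_map_poly)
  have "C = A + smult \<phi> B"
  proof (rule poly_eqI)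
    show "coeff C i = coeff (A + smult \<phi> B) i" for i
      unfolding coeff_add coeff_smult cA cB using monic_div(1) [OF \<phi>, of "coeff C i"]
      by (simp only: add.commute)
  qed
  then have "poly C \<phi> = poly (A + pCons 0 B) \<phi>" by simp
  then have FC: "poly F \<phi> = poly (A + pCons 0 B) \<phi>" unfolding mult C_def by simp
  have degC: "degree (coeff B i) < degree \<phi>" for i
  proof -
    have "degree (coeff D j * coeff E (i - j)) \<le> 2 * (degree \<phi> - 1)" for j
      using degree_mult_le [of "coeff D j" "coeff E (i - j)"] D [of j] E [of "i - j"] by simp
    then have "degree (coeff C i) \<le> 2 * (degree \<phi> - 1)"
      unfolding C_def coeff_mult by (intro degree_sum_le) auto
    then show ?thesis
      unfolding cB using \<phi> by (intro degree_mquot_less) auto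
  qed
  have "F = A + pCons 0 B"
  proof (rule digits_unique [OF \<phi> F _ FC])
    show "degree (coeff (A + pCons 0 B) i) < degree \<phi>" for i
      using monic_div(2) [OF \<phi>] degC \<phi>(2) unfolding coeff_add cA
      by (intro degree_add_less) (auto simp: coeff_pCons split: nat.split)
  qed
  then have F_0: "coeff F 0 = mrem \<phi> (coeff D 0 * coeff E 0)"
    and F_T: "coeff F T = mrem \<phi> (coeff C T) + mquot \<phi> (coeff C (T - 1))"
    using T by (simp_all add: cA cB C_def coeff_mult coeff_pCons split: nat.split)
  have "\<not> ?P ^ Suc e dvd mrem \<phi> (coeff C T)"
  proof
    assume dvd: "?P ^ Suc e dvd mrem \<phi> (coeff C T)"
    have "coeff C T = coeff D r * coeff E s + (\<Sum>i\<in>{..T} - {r}. coeff D i * coeff E (T - i))"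
      unfolding C_def coeff_mult by (subst sum.remove [of _ r]) (auto simp: T_def)
    moreover have "?P ^ Suc e dvd (\<Sum>i\<in>{..T} - {r}. coeff D i * coeff E (T - i))"
      by (intro dvd_sum off_corner) auto
    then obtain y where "(\<Sum>i\<in>{..T} - {r}. coeff D i * coeff E (T - i)) = [:p ^ Suc e:] * y"
      unfolding Pe by blast
    ultimately have CT: "coeff C T = coeff D r * coeff E s + [:p ^ Suc e:] * y" by simp
    obtain g where g: "coeff D r = ?P ^ ?V (coeff D r) * g" "\<not> ?P dvd g"
      using multiplicity_decompose' [of "coeff D r" ?P] r(1) Pu by (auto simp: SD_def)
    obtain h where h: "coeff E s = ?P ^ ?V (coeff E s) * h" "\<not> ?P dvd h"
      using multiplicity_decompose' [of "coeff E s" ?P] s(1) Pu by (auto simp: SE_def)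
    have deg: "degree g < degree \<phi>" "degree h < degree \<phi>"
      using arg_cong [OF g(1), of degree] arg_cong [OF h(1), of degree] D [of r] E [of s] p
      unfolding Pe by simp_all
    have "coeff D r * coeff E s = ?P ^ e * (g * h)"
      by (subst g(1), subst h(1)) (simp only: e_def power_add mult_ac)
    then have "mrem \<phi> (coeff C T) = ?P ^ e * mrem \<phi> (g * h) + ?P ^ Suc e * mrem \<phi> y"
      unfolding CT mrem_add [OF \<phi>] Pe by (simp only: mquot_mrem_const_mult [OF \<phi>])
    with dvd have "?P ^ Suc e dvd ?P ^ e * mrem \<phi> (g * h)"
      by (simp only: dvd_add_times_triv_right_iff dvd_add_left_iff dvd_triv_left)
    then have "?P ^ e * ?P dvd ?P ^ e * mrem \<phi> (g * h)" by (simp only: power_Suc2)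
    then have "?P dvd mrem \<phi> (g * h)" using P0 by (simp only: dvd_mult_cancel_left power_not_zero) simp
    with const_mult_mod [OF p \<phi> irr g(2) deg(1) h(2) deg(2)] show False by blast
  qed
  moreover have "?P ^ Suc e dvd mquot \<phi> (coeff C (T - 1))"
  proof -
    have "?P ^ Suc e dvd coeff C (T - 1)"
      unfolding C_def coeff_mult using T by (intro dvd_sum below) auto
    then obtain y where "coeff C (T - 1) = [:p ^ Suc e:] * y" unfolding Pe by blast
    then show ?thesis unfolding Pe by (simp only: mquot_mrem_const_mult [OF \<phi>] dvd_triv_left)
  qed
  ultimately have "\<not> ?P ^ Suc e dvd coeff F T"
    unfolding F_T using dvd_add_left_iff by blast
  moreover have "?P ^ Suc e dvd coeff F T"
  proof (rule slope [OF T])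
    have "coeff D 0 * coeff E 0 \<noteq> 0" using F0 zero unfolding F_0 by auto
    then have in0: "0 \<in> SD" "0 \<in> SE" by (auto simp: SD_def SE_def)
    let ?n = "?V (coeff D 0) + ?V (coeff E 0)"
    have "?P ^ ?n dvd coeff D 0 * coeff E 0"
      using in0 p by (intro const_power_dvd_mult) (auto simp: SD_def SE_def)
    then obtain y where "coeff D 0 * coeff E 0 = [:p ^ ?n:] * y" unfolding Pe by blast
    then have "?P ^ ?n dvd coeff F 0"
      unfolding F_0 Pe by (simp only: mquot_mrem_const_mult [OF \<phi>] dvd_triv_left)
    then have "?n \<le> v"
      using F0 by (meson dvd_trans le_imp_power_dvd not_less_eq_eq)
    have "k * e + T \<le> k * ?n" using point [OF in0] by simp
    also have "\<dots> \<le> k * v" using \<open>?n \<le> v\<close> by simp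
    finally show "k * e + T \<le> k * v" .
  qed
  ultimately show False by blast
qed

subsection \<open>Ratios of products of odd numbers\<close>

definition odd_tail :: "nat \<Rightarrow> nat \<Rightarrow> int" where
  "odd_tail n j = (\<Prod>i\<in>{i\<in>{2 * j<..2 * n}. odd i}. int i)"

lemma u_mult_odd_tail: "j \<le> n \<Longrightarrow> u (2 * j) * odd_tail n j = u (2 * n)"
proof -
  assume j: "j \<le> n"
  have "{i\<in>{1..2 * n}. odd i} = {i\<in>{1..2 * j}. odd i} \<union> {i\<in>{2 * j<..2 * n}. odd i}"
    using j by auto
  then show ?thesis
    unfolding u_def odd_tail_def by (simp add: prod.union_disjoint disjoint_iff)
qed

lemma u_pos: "u j > 0"
  unfolding u_def by (rule prod_pos) auto

lemma odd_tail_0: "odd_tail n 0 = u (2 * n)"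
  using u_mult_odd_tail [of 0 n] by (simp add: u_def)

lemma dvd_odd_tail: "odd t \<Longrightarrow> 2 * j < t \<Longrightarrow> t \<le> 2 * n \<Longrightarrow> int t dvd odd_tail n j"
  unfolding odd_tail_def by (intro dvd_prodI) auto

lemma multiplicity_u_less:
  assumes q: "prime q" and j: "j > 0"
  shows "(q - 1) * multiplicity (int q) (u (2 * j)) < 2 * j"
proof -
  let ?m = "multiplicity (int q) (u (2 * j))"
  have "int q ^ ?m dvd u (2 * j)" by (rule multiplicity_dvd)
  also have "u (2 * j) dvd (\<Prod>i\<in>{1..2 * j}. int i)"
    unfolding u_def by (intro prod_dvd_prod_subset) auto
  also have "\<dots> = int (fact (2 * j))" by (simp add: fact_prod)
  finally have "int (q ^ ?m) dvd int (fact (2 * j))" by simp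
  then have "q ^ ?m dvd fact (2 * j)" by (simp only: int_dvd_int_iff)
  then have "?m \<le> multiplicity q (fact (2 * j))"
    using q by (intro multiplicity_geI) auto
  then have "(q - 1) * ?m \<le> (q - 1) * multiplicity q (fact (2 * j))" by (rule mult_le_mono2)
  also have "\<dots> < 2 * j" using q j by (intro multiplicity_fact_less) auto
  finally show ?thesis .
qed

text \<open>Valuations subtract in u(2n) / u(2j), and k times that of u(2j) is at most q - 1 times
  it, hence below 2j. This supplies the slope hypothesis of
  \<open>newton_polygon_factor\<close>.\<close>

lemma power_dvd_odd_tail:
  assumes q: "prime q" "k < q" and j: "0 < j" "j \<le> n"
    and le: "k * e + 2 * j \<le> k * multiplicity (int q) (u (2 * n))"
  shows "int q ^ Suc e dvd odd_tail n j"
proof -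
  let ?v = "multiplicity (int q)"
  have pe: "prime_elem (int q)" using q by simp
  have nz: "u (2 * j) \<noteq> 0" "odd_tail n j \<noteq> 0"
    using u_mult_odd_tail [OF j(2)] u_pos [of "2 * n"] by auto
  have v: "?v (u (2 * n)) = ?v (u (2 * j)) + ?v (odd_tail n j)"
    unfolding u_mult_odd_tail [OF j(2), symmetric] using pe nz
    by (intro prime_elem_multiplicity_mult_distrib)
  have "k * ?v (u (2 * j)) \<le> (q - 1) * ?v (u (2 * j))" using q(2) by (intro mult_le_mono1) simp
  also have "\<dots> < 2 * j" using q(1) j(1) by (rule multiplicity_u_less)
  finally have "k * e + k * ?v (u (2 * j)) < k * ?v (u (2 * j)) + k * ?v (odd_tail n j)"
    using le unfolding v distrib_left by linarith
  then have "k * e < k * ?v (odd_tail n j)" by simp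
  then have "Suc e \<le> ?v (odd_tail n j)" by simp
  then show ?thesis by (rule multiplicity_dvd')
qed

subsection \<open>The irreducibility theorem\<close>

locale schur_polynomial =
  fixes n :: nat and an :: int and \<phi> :: "int poly" and a :: "nat \<Rightarrow> int poly"
  assumes n: "n \<ge> 2" and \<phi>: "monic \<phi>"
    and irr: "\<And>p :: int. prime p \<Longrightarrow> p < 2 * int n \<Longrightarrow> poly_mod.irreducible_m p \<phi>"
    and deg_a: "\<And>i. i < n \<Longrightarrow> degree (a i) < degree \<phi>"
    and content: "\<And>p :: int. prime p \<Longrightarrow> p < 2 * int n \<Longrightarrow> \<not> p dvd content (smult an (a 0))"
begin

definition F :: "int poly" where
  "F = smult an (\<phi> ^ (2 * n)) + (\<Sum>j<n. smult (odd_tail n j) (a j) * \<phi> ^ (2 * j))"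

definition digits :: "int poly poly" where
  "digits = monom [:an:] (2 * n) + (\<Sum>j<n. monom (smult (odd_tail n j) (a j)) (2 * j))"

lemma deg_\<phi>: "degree \<phi> > 0"
  using deg_a [of 0] n by simp

lemma poly_digits: "poly digits \<phi> = F"
  by (simp add: digits_def F_def poly_sum poly_monom)

lemma coeff_digits_even: "j < n \<Longrightarrow> coeff digits (2 * j) = smult (odd_tail n j) (a j)"
  by (simp add: digits_def coeff_sum coeff_monom)

lemma coeff_digits_other: "\<forall>j<n. t \<noteq> 2 * j \<Longrightarrow> t \<noteq> 2 * n \<Longrightarrow> coeff digits t = 0"
  by (auto simp: digits_def coeff_sum coeff_monom intro!: sum.neutral)

lemma coeff_digits_top: "coeff digits (2 * n) = [:an:]"
  by (auto simp: digits_def coeff_sum coeff_monom intro!: sum.neutral)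

lemma coeff_digits_cases:
  obtains (even) j where "j < n" "t = 2 * j" | (top) "t = 2 * n" | (other) "coeff digits t = 0"
  using coeff_digits_other by blast

lemma degree_digits: "degree (coeff digits t) < degree \<phi>"
proof (cases t rule: coeff_digits_cases)
  case (even j)
  then show ?thesis
    using coeff_digits_even [of j] deg_a [of j] degree_smult_le [of "odd_tail n j" "a j"] by simp
next
  case top
  then show ?thesis using deg_\<phi> by (simp add: coeff_digits_top)
next
  case other
  then show ?thesis using deg_\<phi> by simp
qed

lemma an_nz: "an \<noteq> 0"
  using content [of 2] n by auto

lemma degree_F: "degree F = 2 * n * degree \<phi>" and lead_F: "lead_coeff F = an"
proof -
  have "\<phi> \<noteq> 0" using \<phi> by auto
  then have pow: "degree (\<phi> ^ t) = t * degree \<phi>" for t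
    using degree_power_eq [of \<phi> t] by (simp add: mult.commute)
  have top: "degree (smult an (\<phi> ^ (2 * n))) = 2 * n * degree \<phi>"
    using an_nz pow by simp
  have "degree (\<Sum>j<n. smult (odd_tail n j) (a j) * \<phi> ^ (2 * j)) < 2 * n * degree \<phi>"
  proof (rule degree_sum_less)
    fix j assume "j \<in> {..<n}"
    then have j: "j < n" by simp
    have "degree (smult (odd_tail n j) (a j) * \<phi> ^ (2 * j)) \<le> degree (a j) + 2 * j * degree \<phi>"
      using degree_mult_le [of "smult (odd_tail n j) (a j)" "\<phi> ^ (2 * j)"]
        degree_smult_le [of "odd_tail n j" "a j"] pow [of "2 * j"] by linarith
    also have "\<dots> < (2 * j + 1) * degree \<phi>" using deg_a [OF j] by simp
    also have "\<dots> \<le> 2 * n * degree \<phi>" using j by (intro mult_le_mono1) simp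
    finally show "degree (smult (odd_tail n j) (a j) * \<phi> ^ (2 * j)) < 2 * n * degree \<phi>" .
  qed (use n deg_\<phi> in simp)
  with top have less: "degree (\<Sum>j<n. smult (odd_tail n j) (a j) * \<phi> ^ (2 * j)) < degree (smult an (\<phi> ^ (2 * n)))"
    by simp
  show deg: "degree F = 2 * n * degree \<phi>"
    unfolding F_def using degree_add_eq_left [OF less] top by simp
  show "lead_coeff F = an"
    unfolding deg top [symmetric] unfolding F_def using less monic_power [OF \<phi>, of "2 * n"] an_nz
    by (simp add: coeff_eq_0)
qed

text \<open>For \<open>j\<close> up to \<open>r\<close> the odd number \<open>t\<close> is a factor
  of \<open>odd_tail n j\<close>; the other terms carry a sufficiently high power of
  \<open>\<phi>\<close>.\<close>

lemma F_mod:
  assumes p: "p = int q" "q dvd t" "odd t" "2 * r < t" "t \<le> 2 * n"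
  shows "\<exists>R. [:p:] dvd F - \<phi> ^ (2 * r + 2) * R"
proof -
  define I where "I = {x. \<exists>R. [:p:] dvd x - \<phi> ^ (2 * r + 2) * R}"
  have add: "x + y \<in> I" if xy: "x \<in> I" "y \<in> I" for x y
  proof -
    obtain R R' where "[:p:] dvd x - \<phi> ^ (2 * r + 2) * R" "[:p:] dvd y - \<phi> ^ (2 * r + 2) * R'"
      using xy by (auto simp: I_def)
    from dvd_add [OF this] have "[:p:] dvd (x + y) - \<phi> ^ (2 * r + 2) * (R + R')"
      by (simp add: algebra_simps)
    then show ?thesis by (auto simp: I_def)
  qed
  have high: "x * \<phi> ^ s \<in> I" if s: "2 * r + 2 \<le> s" for x s
  proof -
    have "\<phi> ^ s = \<phi> ^ (2 * r + 2) * \<phi> ^ (s - (2 * r + 2))"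
      unfolding power_add [symmetric] le_add_diff_inverse [OF s] ..
    then have "x * \<phi> ^ s - \<phi> ^ (2 * r + 2) * (x * \<phi> ^ (s - (2 * r + 2))) = 0" by simp
    then show ?thesis unfolding I_def by (metis (mono_tags, lifting) dvd_0_right mem_Collect_eq)
  qed
  have low: "x \<in> I" if "[:p:] dvd x" for x
    unfolding I_def using that by (auto intro!: exI [of _ 0])
  have summand: "smult (odd_tail n j) (a j) * \<phi> ^ (2 * j) \<in> I" for j
  proof (cases "j \<le> r")
    case True
    then have "int t dvd odd_tail n j" using p by (intro dvd_odd_tail) auto
    then have "p dvd odd_tail n j" using p(1,2) by (meson dvd_trans int_dvd_int_iff)
    then have "[:p:] dvd smult (odd_tail n j) (a j)"
      by (simp add: const_poly_dvd_iff)
    then show ?thesis by (intro low dvd_mult2)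
  qed (intro high, simp)
  have sum: "(\<Sum>j\<in>J. smult (odd_tail n j) (a j) * \<phi> ^ (2 * j)) \<in> I" if "finite J" for J
    using that
  proof (induction J rule: finite_induct)
    case empty
    show ?case unfolding sum.empty by (rule low) simp
  next
    case (insert j J)
    show ?case unfolding sum.insert [OF insert.hyps] using summand insert.IH by (rule add)
  qed
  have "[:an:] * \<phi> ^ (2 * n) \<in> I" 
  proof (rule high)
    have "r < n" using p(4,5) by linarith
    then show "2 * r + 2 \<le> 2 * n" by simp
  qed
  then have "F \<in> I" unfolding F_def using sum [of "{..<n}"] by (intro add) auto
  then show ?thesis by (simp add: I_def)
qed

lemma no_proper_factor:
  assumes GH: "F = G * H" and degG: "degree G > 0" "degree G \<le> degree H"
  shows False
proof -
  define d where "d = degree \<phi>"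
  have d: "d > 0" using deg_\<phi> by (simp add: d_def)
  have "F \<noteq> 0" using degree_F n deg_\<phi> by auto
  then have "G \<noteq> 0" "H \<noteq> 0" using GH by auto
  then have deg: "degree G + degree H = 2 * n * d"
    using degree_F degree_mult_eq [of G H] by (simp add: GH d_def)
  define k where "k = degree G div d"
  have "degree G \<le> n * d" using deg degG(2) by simp
  then have "k \<le> n * d div d" unfolding k_def by (rule div_le_mono)
  then have kn: "k \<le> n" using d by simp
  have kd: "k * d \<le> degree G" by (simp add: k_def)
  define l where "l = (if k = 0 then 1 else (k + 1) div 2)"
  have l: "l \<ge> 1" "2 * l \<le> n + 1" "l < n" "k \<le> 2 * l" using kn n by (auto simp: l_def)
  have lk: "2 * l \<le> k + 1" if "k \<noteq> 0" using that by (simp add: l_def)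
  \<comment> \<open>The run of \<open>l\<close> terms ends at 2n - 1; 2l at most n + 1 gives m at
    least 2l - 1, and l < n gives m at least 3.\<close>
  define m where "m = 2 * (n - l) + 1"
  have "odd m" "m \<ge> 2 * l - 1" "m \<ge> 3" using l by (auto simp: m_def)
  from consecutive_odd_large_prime_factor [OF this l(1)]
  obtain q i where q: "prime q" "i < l" "q dvd m + 2 * i" "2 * l < q" by blast
  define p where "p = int q"
  have p: "prime p" using q(1) by (simp add: p_def)
  have t_le: "m + 2 * i \<le> 2 * n - 1" using q(2) l by (simp add: m_def)
  have "q \<le> m + 2 * i" using q(3) by (rule dvd_imp_le) (simp add: m_def)
  then have p_less: "p < 2 * int n" using t_le n by (simp add: p_def)
  note irr_p = irr [OF p p_less]
  \<comment> \<open>Used twice: for \<open>an\<close>, hence for the leading coefficients of both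
    factors, and for \<open>a 0\<close>, hence for digit 0 of \<open>F\<close>.\<close>
  have not_dvd: "\<not> [:p:] dvd smult an (a 0)"
    using content [OF p p_less] by (simp add: const_poly_dvd_iff_dvd_content)
  have "\<not> p dvd an"
  proof
    assume "p dvd an"
    then have "[:p:] dvd smult an (a 0)" by (simp add: const_poly_dvd_iff)
    with not_dvd show False by simp
  qed
  moreover have "an = lead_coeff G * lead_coeff H"
    using lead_F unfolding GH by (simp only: lead_coeff_mult)
  ultimately have lead: "\<not> p dvd lead_coeff G" "\<not> p dvd lead_coeff H" by auto
  then have GHp: "\<not> [:p:] dvd G" "\<not> [:p:] dvd H" by (auto simp: const_poly_dvd_iff)
  have a0: "\<not> [:p:] dvd a 0" using not_dvd dvd_smult by blast
  obtain R where R: "[:p:] dvd G * H - \<phi> ^ (2 * (n - l) + 2) * R"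
  proof -
    have "odd (m + 2 * i)" "2 * (n - l) < m + 2 * i" "m + 2 * i \<le> 2 * n"
      using t_le by (simp_all add: m_def)
    from F_mod [OF p_def q(3) this] show ?thesis using that unfolding GH by blast
  qed
  have "\<exists>h. [:p:] dvd G - \<phi> * h"
  proof (rule ccontr)
    assume "\<nexists>h. [:p:] dvd G - \<phi> * h"
    from power_dvd_cancel_mod [OF p \<phi> irr_p this R]
    obtain B where "[:p:] dvd H - \<phi> ^ (2 * (n - l) + 2) * B" by blast
    from degree_ge_power_mod [OF \<phi> this GHp(2)]
    have ge: "(2 * (n - l) + 2) * d \<le> degree H" by (simp add: d_def)
    show False
    \<comment> \<open>For k = 0 the power is phi^(2n), leaving no degree for \<open>G\<close>.
      Otherwise the two degrees add up to at least (2n + 1) d instead of 2n d.\<close>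
    proof (cases "k = 0")
      case True
      then have "2 * (n - l) + 2 = 2 * n" using n by (simp add: l_def)
      with ge have "2 * n * d \<le> degree H" by metis
      with deg degG(1) show False by linarith
    next
      case False
      have "(2 * l - 1) * d \<le> k * d" using lk [OF False] by (intro mult_le_mono1) simp
      then have "(2 * l - 1) * d + (2 * (n - l) + 2) * d \<le> 2 * n * d"
        using kd ge deg by linarith
      then have "(2 * l - 1 + (2 * (n - l) + 2)) * d \<le> 2 * n * d" by (simp only: distrib_right)
      moreover have "2 * l - 1 + (2 * (n - l) + 2) = Suc (2 * n)" using l by simp
      ultimately have "Suc (2 * n) * d \<le> 2 * n * d" by (simp only:)
      then show False using d by simp
    qed
  qed
  then obtain h where h: "[:p:] dvd G - \<phi> * h" by blast
  have "k \<ge> 1"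
  proof (rule ccontr)
    assume "\<not> k \<ge> 1"
    then have "degree G < degree \<phi>"
      using d div_greater_zero_iff [of "degree G" d] by (simp add: k_def d_def)
    from const_dvd_reduce [OF \<phi> this h] GHp(1) show False by simp
  qed
  obtain D where D: "poly D \<phi> = G" "\<And>i. degree (coeff D i) < degree \<phi>" "degree D = k"
    "lead_coeff (lead_coeff D) = lead_coeff G"
    using digits_exist [OF \<phi> deg_\<phi>, of G] by (auto simp: k_def d_def)
  obtain E where E: "poly E \<phi> = H" "\<And>i. degree (coeff E i) < degree \<phi>"
    using digits_exist [OF \<phi> deg_\<phi>, of H] by blast
  have D0: "[:p:] dvd coeff D 0"
  proof (cases D)
    case (pCons c D')
    have dvd: "[:p:] dvd c - \<phi> * (h - poly D' \<phi>)"
      using h unfolding D(1) [symmetric] pCons by (simp add: algebra_simps)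
    have "degree c < degree \<phi>" using D(2) [of 0] by (simp add: pCons)
    from const_dvd_reduce [OF \<phi> this dvd] show ?thesis by (simp add: pCons)
  qed
  have Dk: "\<not> [:p:] dvd coeff D k"
  proof
    assume "[:p:] dvd coeff D k"
    then have "p dvd lead_coeff (lead_coeff D)" unfolding D(3) const_poly_dvd_iff by blast
    with lead(1) show False unfolding D(4) by blast
  qed
  let ?v = "multiplicity p (u (2 * n))"
  have u0: "u (2 * n) \<noteq> 0" using u_pos [of "2 * n"] by simp
  have Pe: "[:p:] ^ e = [:p ^ e:]" for e by (simp add: poly_const_pow)
  have pu: "\<not> is_unit p" using p not_prime_unit by blast
  show False
  proof (rule newton_polygon_factor [OF p \<phi> deg_\<phi> irr_p D(2) E(2) degree_digits _ _ _ \<open>k \<ge> 1\<close> D0 Dk])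
    show "poly digits \<phi> = poly D \<phi> * poly E \<phi>" by (simp only: poly_digits D(1) E(1) GH)
    show "\<not> [:p:] ^ Suc ?v dvd coeff digits 0"
    proof
      assume dvd: "[:p:] ^ Suc ?v dvd coeff digits 0"
      obtain w where w: "u (2 * n) = p ^ ?v * w" "\<not> p dvd w"
        using multiplicity_decompose' [OF u0 pu] by blast
      have "coeff digits 0 = smult (u (2 * n)) (a 0)"
        using coeff_digits_even [of 0] n by (simp add: odd_tail_0)
      also have "\<dots> = [:p:] ^ ?v * ([:w:] * a 0)"
        by (subst w(1)) (simp add: Pe mult.commute)
      finally have "[:p:] ^ ?v * [:p:] dvd [:p:] ^ ?v * ([:w:] * a 0)"
        using dvd by (simp only: power_Suc2)
      then have "[:p:] dvd [:w:] * a 0" using p by (simp only: dvd_mult_cancel_left) auto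
      then have "[:p:] dvd [:w:] \<or> [:p:] dvd a 0"
        by (rule prime_elem_dvd_multD [OF prime_elem_const_int [OF p]])
      with w(2) a0 show False by (simp add: const_poly_dvd)
    qed
    show "[:p:] ^ Suc e dvd coeff digits t" if t: "t \<ge> 1" "k * e + t \<le> k * ?v" for t e
    proof (cases t rule: coeff_digits_cases)
      case (even j)
      have "int q ^ Suc e dvd odd_tail n j"
        by (rule power_dvd_odd_tail [of _ k]) (use q l t even p_def in auto)
      then show ?thesis
        using even coeff_digits_even [of j] unfolding Pe by (simp add: const_poly_dvd_iff p_def)
    next
      case top
      \<comment> \<open>The top digit \<open>an\<close> is prime to \<open>p\<close>, so this case
        has to be excluded: the valuation bound contradicts the inequality for
        \<open>t = 2 * n\<close>.\<close>
      have "k * ?v \<le> (q - 1) * ?v" using q(4) l(4) by (intro mult_le_mono1) simp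
      also have "\<dots> < 2 * n" unfolding p_def using q(1) n by (intro multiplicity_u_less) auto
      finally show ?thesis using t top by simp
    qed simp
  qed
qed

end


section \<open>Gauss's lemma: from rational to integral factorizations\<close>

lemma int_poly_factor_descent:
  fixes F G H :: "int poly"
  assumes "K \<noteq> 0" "smult K F = G * H"
  shows "\<exists>G' H'. F = G' * H' \<and> degree G' = degree G \<and> degree H' = degree H"
  using assms
proof (induction "nat \<bar>K\<bar>" arbitrary: K G H rule: less_induct)
  case less
  show ?case
  proof (cases "\<bar>K\<bar> = 1")
    case True
    then have "K * K = 1" by (metis abs_mult_self_eq mult_1)
    then have "F = smult K (smult K F)" by simp
    also have "\<dots> = smult K G * H" unfolding less.prems(2) by simp
    finally show ?thesis using less.prems(1) by (intro exI [of _ "smult K G"] exI [of _ H]) simp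
  next
    case False
    \<comment> \<open>As a constant polynomial \<open>p\<close> is a prime element, so it divides
      one of the factors and can be cancelled without changing degrees.\<close>
    then obtain p where p: "prime p" "p dvd K" using prime_factor_int by blast
    then obtain K' where K': "K = p * K'" by blast
    have p1: "p > 1" using p(1) by (rule prime_gt_1_int)
    have "K' \<noteq> 0" using less.prems(1) K' by auto
    then have smaller: "nat \<bar>K'\<bar> < nat \<bar>K\<bar>"
      using p1 by (simp add: K' abs_mult)
    have eq: "[:p:] * smult K' F = G * H" using less.prems(2) by (simp add: K' mult.commute)
    then have "[:p:] dvd G * H" by (metis dvd_triv_left)
    then have "[:p:] dvd G \<or> [:p:] dvd H"
      by (rule prime_elem_dvd_multD [OF prime_elem_const_int [OF p(1)]])
    then show ?thesis
    proof
      assume "[:p:] dvd G"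
      then obtain G0 where G0: "G = [:p:] * G0" by blast
      then have "[:p:] * smult K' F = [:p:] * (G0 * H)" using eq by (simp only: mult.assoc)
      then have "smult K' F = G0 * H" using p1 by (subst (asm) mult_cancel_left) simp
      from less.hyps [OF smaller \<open>K' \<noteq> 0\<close> this] show ?thesis using p1 by (simp add: G0)
    next
      assume "[:p:] dvd H"
      then obtain H0 where H0: "H = [:p:] * H0" by blast
      then have "[:p:] * smult K' F = [:p:] * (G * H0)" using eq by (simp only: mult.left_commute)
      then have "smult K' F = G * H0" using p1 by (subst (asm) mult_cancel_left) simp
      from less.hyps [OF smaller \<open>K' \<noteq> 0\<close> this] show ?thesis using p1 by (simp add: H0)
    qed
  qed
qed

lemma clear_denominators:
  fixes g :: "rat poly"
  shows "\<exists>k G. k \<noteq> 0 \<and> smult (of_int k) g = of_int_poly G"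
proof (induction g)
  case 0
  show ?case by (intro exI [of _ 1] exI [of _ 0]) simp
next
  case (pCons a g)
  then obtain k G where k: "k \<noteq> 0" "smult (of_int k) g = of_int_poly G" by blast
  obtain x y where xy: "quotient_of a = (x, y)" by force
  have y: "y \<noteq> 0" using quotient_of_denom_pos [OF xy] by simp
  have a: "a = of_int x / of_int y" using xy by (rule quotient_of_div)
  have "smult (of_int (y * k)) (pCons a g) = pCons (of_int (k * x)) (smult (of_int y) (smult (of_int k) g))"
    using y by (simp add: a)
  also have "\<dots> = of_int_poly (pCons (k * x) (smult y G))"
    unfolding k(2) by (simp add: hom_distribs)
  finally show ?case using k(1) y by (intro exI [of _ "y * k"]) auto
qed

lemma rat_factor_to_int_factor:
  fixes F :: "int poly" and g h :: "rat poly"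
  assumes "of_int_poly F = g * h"
  shows "\<exists>G H. F = G * H \<and> degree G = degree g \<and> degree H = degree h"
proof -
  obtain k G where k: "k \<noteq> 0" "smult (of_int k) g = of_int_poly G"
    using clear_denominators by blast
  obtain k' H where k': "k' \<noteq> 0" "smult (of_int k') h = of_int_poly H"
    using clear_denominators by blast
  have "of_int_poly (smult (k * k') F) = smult (of_int k) g * smult (of_int k') h"
    using assms by (simp add: hom_distribs mult.commute)
  also have "\<dots> = of_int_poly (G * H)" unfolding k(2) k'(2) by (simp add: hom_distribs)
  finally have "smult (k * k') F = G * H" by simp
  moreover have "degree G = degree g" "degree H = degree h"
    using arg_cong [OF k(2), of degree] arg_cong [OF k'(2), of degree] k(1) k'(1) by simp_all
  ultimately show ?thesis using int_poly_factor_descent [of "k * k'" F G H] k(1) k'(1) by simp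
qed

lemma irreducible_rat_polyI:
  fixes f :: "rat poly" and F :: "int poly"
  assumes f: "smult c f = of_int_poly F" "c \<noteq> 0" and deg: "degree F > 0"
    and no_factor: "\<And>G H. F = G * H \<Longrightarrow> degree G > 0 \<Longrightarrow> degree G \<le> degree H \<Longrightarrow> False"
  shows "irreducible f"
proof (rule irreducibleI)
  have "degree f = degree F" using arg_cong [OF f(1), of degree] f(2) by simp
  with deg show "f \<noteq> 0" "\<not> is_unit f" by (auto simp: is_unit_iff_degree)
  fix g h assume gh: "f = g * h"
  show "is_unit g \<or> is_unit h"
  proof (rule ccontr)
    assume "\<not> (is_unit g \<or> is_unit h)"
    then have pos: "degree g > 0" "degree h > 0"
      using \<open>f \<noteq> 0\<close> gh by (auto simp: is_unit_iff_degree)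
    have "of_int_poly F = smult c g * h" using f(1) unfolding gh by simp
    from rat_factor_to_int_factor [OF this] obtain G H where
      "F = G * H" "degree G = degree g" "degree H = degree h" using f(2) by auto
    with pos show False
      using no_factor [of G H] no_factor [of H G] by (simp add: mult.commute nat_le_linear) linarith
  qed
qed

theorem theorem1p3:
  fixes n :: nat and an :: int and phi :: "int poly" and a :: "nat \<Rightarrow> int poly"
  assumes "n \<ge> 2"
    and "monic phi"
    and "\<forall>p::int. prime p \<and> p < 2 * int n \<longrightarrow> irreducible_mod p phi"
    and "\<forall>i<n. degree (a i) < degree phi"
    and "\<forall>p::int. prime p \<and> p < 2 * int n \<longrightarrow> \<not> p dvd content (smult an (a 0))"
  shows "irreducible
     (smult (of_int an / of_int (u (2*n))) (of_int_poly phi ^ (2*n))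
      + (\<Sum>j<n. of_int_poly (a j) * smult (1 / of_int (u (2*j))) (of_int_poly phi ^ (2*j)))
      :: rat poly)"
proof -
  interpret schur_polynomial n an phi a
    using assms by unfold_locales (auto simp: irreducible_mod_def)
  have u0: "of_int (u (2 * n)) \<noteq> (0 :: rat)" using u_pos [of "2 * n"] by simp
  have ratio: "of_int (u (2 * n)) / of_int (u (2 * j)) = (of_int (odd_tail n j) :: rat)" if "j < n" for j
  proof -
    have "of_int (u (2 * n)) = (of_int (u (2 * j)) * of_int (odd_tail n j) :: rat)"
      using u_mult_odd_tail [of j n] that by (metis less_imp_le of_int_mult)
    then show ?thesis using u_pos [of "2 * j"] by simp
  qed
  have "(\<Sum>j<n. smult (of_int (u (2 * n)))
        (of_int_poly (a j) * smult (1 / of_int (u (2*j))) (of_int_poly phi ^ (2*j)))) =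
      (\<Sum>j<n. smult (of_int (odd_tail n j)) (of_int_poly (a j)) * of_int_poly phi ^ (2 * j) :: rat poly)"
    by (intro sum.cong refl) (simp add: ratio)
  then have scaled: "smult (of_int (u (2 * n)))
      (smult (of_int an / of_int (u (2*n))) (of_int_poly phi ^ (2*n))
        + (\<Sum>j<n. of_int_poly (a j) * smult (1 / of_int (u (2*j))) (of_int_poly phi ^ (2*j))))
      = (of_int_poly F :: rat poly)"
    using u0 by (simp add: F_def smult_add_right smult_sum2 hom_distribs)
  show ?thesis
  proof (rule irreducible_rat_polyI [OF scaled u0])
    show "degree F > 0" using n deg_\<phi> by (simp add: degree_F)
    show False if "F = G * H" "degree G > 0" "degree G \<le> degree H" for G H
      using that by (rule no_proper_factor)
  qed
qed

end
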